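(* Let $P$ be a minuscule poset. Then $\sum_{p\in P}T_p^-\equiv^q \frac{\sum_{p\in P}q^{\mathrm{rk}(p)}}{[\mathrm{rk}(P)+2]_q}$.
   Context: Minuscule posets are the posets attached to a Dynkin diagram with a minuscule node; up to isomorphism they are: rectangles $[a]\times[b]$ (product order); shifted staircases $\{(i,j)\colon1\le i\le j\le n\}$ with componentwise order; double-tailed diamonds $d_n(1)$ ($n\ge2$): a chain $x_1<\dots<x_{n-1}$, two incomparable $y_1,y_2$, a chain $z_{n-1}<\dots<z_1$, with $x_i<y_j<z_k$ for all $i,j,k$; and the exceptional minuscule posets $\Lambda_{E_6}$ and $\Lambda_{E_7}$ of types $E_6,E_7$. They are graded; $\mathrm{rk}$ is the rank function with minimal elements of rank $0$ and $\mathrm{rk}(P)$ is the maximum rank. $\mathcal{J}(P)$ is the set of order ideals. For $p\in P$, $I\in\mathcal{J}(P)$: $T_p^+(I)=1$ if $p$ is minimal in $P\setminus I$, else $0$; $T_p^-(I)=1$ if $p$ is maximal in $I$, else $0$; $T_p^q=T_p^+-qT_p^-$ with $q$ an indeterminate. $f\equiv^q g$ means $f-g=\sum_{p\in P}c_p(q)T_p^q$ for some $c_p(q)\in\mathbb{R}(q)$; an element of $\mathbb{R}(q)$ denotes a constant function. $[m]_q=1+q+\dots+q^{m-1}$. *)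

theory Defs
  imports "HOL-Computational_Algebra.Polynomial" "HOL-Computational_Algebra.Fraction_Field"
begin

type_synonym ratfun = "real poly fract"

definition qvar :: ratfun where
  "qvar = Fract [:0, 1:] 1"

definition qint :: "nat \<Rightarrow> ratfun" where
  "qint m = (\<Sum>i<m. qvar ^ i)"

definition strict_lt :: "('a \<Rightarrow> 'a \<Rightarrow> bool) \<Rightarrow> 'a \<Rightarrow> 'a \<Rightarrow> bool" where
  "strict_lt le x y \<longleftrightarrow> le x y \<and> x \<noteq> y"

definition order_ideals :: "'a set \<Rightarrow> ('a \<Rightarrow> 'a \<Rightarrow> bool) \<Rightarrow> 'a set set" where
  "order_ideals P le = {I. I \<subseteq> P \<and> (\<forall>x\<in>I. \<forall>y\<in>P. le y x \<longrightarrow> y \<in> I)}"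

text \<open>Rank: length of a longest strict chain in P ending at p (minimal elements have rank 0);
  for the graded posets considered here this is the rank function.\<close>
definition is_chain_to :: "'a set \<Rightarrow> ('a \<Rightarrow> 'a \<Rightarrow> bool) \<Rightarrow> 'a list \<Rightarrow> 'a \<Rightarrow> bool" where
  "is_chain_to P le xs p \<longleftrightarrow> xs \<noteq> [] \<and> set xs \<subseteq> P \<and> sorted_wrt (strict_lt le) xs \<and> last xs = p"

definition rk :: "'a set \<Rightarrow> ('a \<Rightarrow> 'a \<Rightarrow> bool) \<Rightarrow> 'a \<Rightarrow> nat" where
  "rk P le p = Max {length xs - 1 | xs. is_chain_to P le xs p}"

definition rkP :: "'a set \<Rightarrow> ('a \<Rightarrow> 'a \<Rightarrow> bool) \<Rightarrow> nat" where
  "rkP P le = Max (rk P le ` P)"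

definition Tplus :: "'a set \<Rightarrow> ('a \<Rightarrow> 'a \<Rightarrow> bool) \<Rightarrow> 'a \<Rightarrow> 'a set \<Rightarrow> ratfun" where
  "Tplus P le p I = of_bool (p \<in> P - I \<and> (\<forall>y\<in>P - I. \<not> strict_lt le y p))"

definition Tminus :: "'a set \<Rightarrow> ('a \<Rightarrow> 'a \<Rightarrow> bool) \<Rightarrow> 'a \<Rightarrow> 'a set \<Rightarrow> ratfun" where
  "Tminus P le p I = of_bool (p \<in> I \<and> (\<forall>y\<in>I. \<not> strict_lt le p y))"

definition Tq :: "'a set \<Rightarrow> ('a \<Rightarrow> 'a \<Rightarrow> bool) \<Rightarrow> 'a \<Rightarrow> 'a set \<Rightarrow> ratfun" where
  "Tq P le p I = Tplus P le p I - qvar * Tminus P le p I"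

definition q_equiv :: "'a set \<Rightarrow> ('a \<Rightarrow> 'a \<Rightarrow> bool) \<Rightarrow> ('a set \<Rightarrow> ratfun) \<Rightarrow> ('a set \<Rightarrow> ratfun) \<Rightarrow> bool" where
  "q_equiv P le f g \<longleftrightarrow>
     (\<exists>c :: 'a \<Rightarrow> ratfun. \<forall>I\<in>order_ideals P le. f I - g I = (\<Sum>p\<in>P. c p * Tq P le p I))"

definition list_le :: "nat list \<Rightarrow> nat list \<Rightarrow> bool" where
  "list_le xs ys \<longleftrightarrow> list_all2 (\<le>) xs ys"

definition rect_set :: "nat \<Rightarrow> nat \<Rightarrow> nat list set" where
  "rect_set a b = {[i, j] | i j. 1 \<le> i \<and> i \<le> a \<and> 1 \<le> j \<and> j \<le> b}"

definition stair_set :: "nat \<Rightarrow> nat list set" where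
  "stair_set n = {[i, j] | i j. 1 \<le> i \<and> i \<le> j \<and> j \<le> n}"

text \<open>Double-tailed diamond d_n(1): x_i encoded [0,i], y_j encoded [1,j], z_k encoded [2,k]\<close>
definition diamond_set :: "nat \<Rightarrow> nat list set" where
  "diamond_set n = {[0, i] | i. 1 \<le> i \<and> i \<le> n - 1} \<union> {[1, 1], [1, 2]}
                   \<union> {[2, k] | k. 1 \<le> k \<and> k \<le> n - 1}"

definition diamond_le :: "nat list \<Rightarrow> nat list \<Rightarrow> bool" where
  "diamond_le u v \<longleftrightarrow>
     (let t = u ! 0; i = u ! 1; s = v ! 0; j = v ! 1 in
        (t = 0 \<and> s = 0 \<and> i \<le> j) \<or>
        (t = 1 \<and> s = 1 \<and> i = j) \<or>
        (t = 2 \<and> s = 2 \<and> j \<le> i) \<or>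
        (t < s))"

text \<open>Exceptional minuscule posets: positive roots with coefficient 1 at the minuscule simple
  root (Bourbaki labelling: alpha_1 for E6, alpha_7 for E7), written in simple-root coordinates,
  ordered by the root order (componentwise).\<close>
definition E6_set :: "nat list set" where
  "E6_set = {[1,0,0,0,0,0], [1,0,1,0,0,0], [1,0,1,1,0,0], [1,0,1,1,1,0], [1,0,1,1,1,1],
    [1,1,1,1,0,0], [1,1,1,1,1,0], [1,1,1,1,1,1], [1,1,1,2,1,0], [1,1,1,2,1,1], [1,1,1,2,2,1],
    [1,1,2,2,1,0], [1,1,2,2,1,1], [1,1,2,2,2,1], [1,1,2,3,2,1], [1,2,2,3,2,1]}"

definition E7_set :: "nat list set" where
  "E7_set = {[0,0,0,0,0,0,1], [0,0,0,0,0,1,1], [0,0,0,0,1,1,1], [0,0,0,1,1,1,1], [0,0,1,1,1,1,1],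
    [0,1,0,1,1,1,1], [0,1,1,1,1,1,1], [0,1,1,2,1,1,1], [0,1,1,2,2,1,1], [0,1,1,2,2,2,1],
    [1,0,1,1,1,1,1], [1,1,1,1,1,1,1], [1,1,1,2,1,1,1], [1,1,1,2,2,1,1], [1,1,1,2,2,2,1],
    [1,1,2,2,1,1,1], [1,1,2,2,2,1,1], [1,1,2,2,2,2,1], [1,1,2,3,2,1,1], [1,1,2,3,2,2,1],
    [1,1,2,3,3,2,1], [1,2,2,3,2,1,1], [1,2,2,3,2,2,1], [1,2,2,3,3,2,1], [1,2,2,4,3,2,1],
    [1,2,3,4,3,2,1], [2,2,3,4,3,2,1]}"

definition minuscule_model :: "nat list set \<Rightarrow> (nat list \<Rightarrow> nat list \<Rightarrow> bool) \<Rightarrow> bool" where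
  "minuscule_model Q leQ \<longleftrightarrow>
     (\<exists>a b. 1 \<le> a \<and> 1 \<le> b \<and> Q = rect_set a b \<and> leQ = list_le) \<or>
     (\<exists>n. 1 \<le> n \<and> Q = stair_set n \<and> leQ = list_le) \<or>
     (\<exists>n. 2 \<le> n \<and> Q = diamond_set n \<and> leQ = diamond_le) \<or>
     (Q = E6_set \<and> leQ = list_le) \<or>
     (Q = E7_set \<and> leQ = list_le)"

definition minuscule :: "'a set \<Rightarrow> ('a \<Rightarrow> 'a \<Rightarrow> bool) \<Rightarrow> bool" where
  "minuscule P le \<longleftrightarrow>
     (\<exists>Q leQ f. minuscule_model Q leQ \<and> bij_betw f P Q \<and>
        (\<forall>x\<in>P. \<forall>y\<in>P. le x y \<longleftrightarrow> leQ (f x) (f y)))"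

end

theory Submission
  imports Defs
begin

text \<open>
  All five families admit explicit coefficients. For a rectangle, an ideal is a lattice path, and
  with suitable coefficients the difference of the two sides is an alternating sum over the corners
  of the path of weights \<^term>\<open>A i + B j\<close>, which telescopes because consecutive corners share a
  coordinate. A shifted staircase is the quotient of a square by transposition, and its ideals are the
  symmetric ideals of the square. Double-tailed diamonds are two chains glued to a pair of
  incomparable elements, and telescope along the chains. The posets of types $E_6$ and $E_7$ have 27
  and 56 ideals, which are checked one by one against a table of coefficients.
\<close>

text \<open>For any c, \<open>Tminus - c * Tq\<close> equals
  \<open>- c * Tplus + (1 + qvar * c) * Tminus\<close>. So a function c on P is sought such that -c,
  summed over the elements that can be added to I, plus 1 + q c, summed over those that can be
  removed, has the same value C for every ideal I. Each model has a least element, and the empty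
  ideal shows that C must be -c there. In a rectangle the two weights of a box belong to opposite
  vertices: F = -c at the vertex where the box is added, 1 - q F at the one where it is removed.
  They come, up to sign, from one function on lattice points when F(i+1, j+1) = q F(i, j) - 1.
  Requiring F = 0 at both ends of the path then fixes F = A + B. In the staircase the diagonal
  spoils the factor 2: its elements are counted only once in the square. Their contribution is
  equivalent to 1/(1+q), which joins the constant. For the two exceptional posets the denominators
  are cleared, so that identities in R(q) become comparisons of integer lists, which can be
  evaluated.\<close>

subsection \<open>The indeterminate\<close>

lemma qvar_power: "qvar ^ m = Fract (monom 1 m) 1"
proof (induction m)
  case 0
  show ?case
    by (simp add: One_fract_def)
next
  case (Suc m)
  then show ?case
    by (simp add: qvar_def monom_Suc)
qed

text \<open>Here the indeterminacy of q enters, through a comparison of degrees. The non-vanishing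
  of \<open>qint m\<close> and of 1 + q^m is deduced from it.\<close>

lemma qvar_power_neq_1: "0 < m \<Longrightarrow> qvar ^ m \<noteq> 1"
proof
  assume "0 < m" "qvar ^ m = 1"
  then have "monom (1 :: real) m = 1"
    by (simp add: qvar_power One_fract_def eq_fract)
  then have "degree (monom (1 :: real) m) = 0"
    by simp
  with \<open>0 < m\<close> show False
    by (simp add: degree_monom_eq)
qed

lemma qint_mult: "(1 - qvar) * qint m = 1 - qvar ^ m"
  unfolding qint_def by (rule one_diff_power_eq[symmetric])

lemma qint_0 [simp]: "qint 0 = 0"
  by (simp add: qint_def)

lemma qint_Suc: "qint (Suc m) = qint m + qvar ^ m"
  by (simp add: qint_def)

lemma qint_Suc_shift: "qint (Suc m) = 1 + qvar * qint m"
  unfolding qint_def sum.lessThan_Suc_shift by (simp add: sum_distrib_left)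

lemma qint_neq_0: "0 < m \<Longrightarrow> qint m \<noteq> 0"
  using qint_mult[of m] qvar_power_neq_1[of m] by auto

lemma one_plus_qvar_power_neq_0: "0 < m \<Longrightarrow> 1 + qvar ^ m \<noteq> 0"
proof
  assume "0 < m" and "1 + qvar ^ m = 0"
  then have "(1 + qvar ^ m) * (1 - qvar ^ m) = 0"
    by simp
  then have "qvar ^ (2 * m) = 1"
    by (simp add: algebra_simps flip: power_add mult_2)
  with \<open>0 < m\<close> qvar_power_neq_1[of "2 * m"] show False
    by simp
qed

subsection \<open>Rank functions\<close>

lemma chain_length_le:
  assumes mono: "\<And>x y. x \<in> P \<Longrightarrow> y \<in> P \<Longrightarrow> strict_lt le x y \<Longrightarrow> \<rho> x < (\<rho> y :: nat)"
    and "is_chain_to P le xs p"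
  shows "length xs \<le> Suc (\<rho> p)"
  using assms(2)
proof (induction xs arbitrary: p rule: rev_induct)
  case (snoc x xs)
  show ?case
  proof (cases "xs = []")
    case False
    then have "is_chain_to P le xs (last xs)" "strict_lt le (last xs) p" "last xs \<in> P" "p \<in> P"
      using snoc.prems by (auto simp: is_chain_to_def sorted_wrt_append)
    with snoc.IH mono show ?thesis
      by fastforce
  qed simp
qed simp

lemma ex_chain_of_length:
  assumes trans: "\<And>x y z. x \<in> P \<Longrightarrow> y \<in> P \<Longrightarrow> z \<in> P \<Longrightarrow>
      strict_lt le x y \<Longrightarrow> strict_lt le y z \<Longrightarrow> strict_lt le x z"
    and pred: "\<And>p. p \<in> P \<Longrightarrow> \<rho> p \<noteq> 0 \<Longrightarrow> \<exists>y\<in>P. strict_lt le y p \<and> Suc (\<rho> y) = \<rho> p"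
    and "p \<in> P"
  shows "\<exists>xs. is_chain_to P le xs p \<and> length xs = Suc (\<rho> p)"
  using \<open>p \<in> P\<close>
proof (induction "\<rho> p" arbitrary: p)
  case 0
  then have "is_chain_to P le [p] p"
    by (simp add: is_chain_to_def)
  with 0 show ?case
    by (metis length_Cons list.size(3))
next
  case (Suc n)
  then obtain y where y: "y \<in> P" "strict_lt le y p" "Suc (\<rho> y) = \<rho> p"
    using pred[of p] by auto
  with Suc obtain xs where xs: "is_chain_to P le xs y" "length xs = Suc (\<rho> y)"
    by force
  have "strict_lt le z p" if "z \<in> set xs" for z
  proof (cases "z = y")
    case False
    have "xs = butlast xs @ [y]"
      using xs(1) by (metis append_butlast_last_id is_chain_to_def)
    moreover have "sorted_wrt (strict_lt le) xs" "set xs \<subseteq> P"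
      using xs(1) by (auto simp: is_chain_to_def)
    ultimately have "z \<in> set (butlast xs)" "\<forall>z\<in>set (butlast xs). strict_lt le z y"
      using that False
      by (metis UnE empty_iff empty_set insert_iff list.simps(15) set_append)
        (metis \<open>xs = butlast xs @ [y]\<close> \<open>sorted_wrt (strict_lt le) xs\<close> list.set_intros(1) sorted_wrt_append)
    with trans y \<open>set xs \<subseteq> P\<close> that Suc.prems show ?thesis
      by blast
  qed (use y in simp)
  with xs Suc.prems have "is_chain_to P le (xs @ [p]) p"
    by (auto simp: is_chain_to_def sorted_wrt_append)
  with xs y show ?case
    by (metis length_append_singleton)
qed

text \<open>Monotonicity bounds the length of every chain ending at p by
  \<open>\<rho> p + 1\<close>, which also makes the set under \<open>Max\<close> finite; descending
  by \<open>pred\<close> yields a chain attaining the bound. Transitivity enters because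
  \<open>sorted_wrt\<close> compares all pairs, not just neighbours.\<close>

lemma rk_eqI:
  assumes trans: "\<And>x y z. x \<in> P \<Longrightarrow> y \<in> P \<Longrightarrow> z \<in> P \<Longrightarrow>
      strict_lt le x y \<Longrightarrow> strict_lt le y z \<Longrightarrow> strict_lt le x z"
    and mono: "\<And>x y. x \<in> P \<Longrightarrow> y \<in> P \<Longrightarrow> strict_lt le x y \<Longrightarrow> \<rho> x < \<rho> y"
    and pred: "\<And>p. p \<in> P \<Longrightarrow> \<rho> p \<noteq> 0 \<Longrightarrow> \<exists>y\<in>P. strict_lt le y p \<and> Suc (\<rho> y) = \<rho> p"
    and "p \<in> P"
  shows "rk P le p = \<rho> p"
proof -
  let ?L = "{length xs - 1 | xs. is_chain_to P le xs p}"
  have bound: "k \<le> \<rho> p" if "k \<in> ?L" for k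
    using that chain_length_le[of P le \<rho>] mono by fastforce
  obtain xs where "is_chain_to P le xs p" "length xs = Suc (\<rho> p)"
    using ex_chain_of_length[of P le \<rho> p] trans pred \<open>p \<in> P\<close> by blast
  then have "\<rho> p \<in> ?L"
    by force
  moreover have "finite ?L"
    using bound by (meson finite_nat_set_iff_bounded_le)
  ultimately show ?thesis
    unfolding rk_def using bound by (intro Max_eqI) auto
qed

lemma is_chain_to_map:
  assumes "is_chain_to P le xs p" and "f ` P \<subseteq> Q"
    and "\<And>x y. x \<in> P \<Longrightarrow> y \<in> P \<Longrightarrow> strict_lt le x y \<Longrightarrow> strict_lt leQ (f x) (f y)"
  shows "is_chain_to Q leQ (map f xs) (f p)"
proof -
  have "sorted_wrt (\<lambda>x y. strict_lt leQ (f x) (f y)) xs"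
    using assms(1,3) unfolding is_chain_to_def
    by (metis (no_types, lifting) sorted_wrt_mono_rel subset_iff)
  then show ?thesis
    using assms(1,2) by (auto simp: is_chain_to_def sorted_wrt_map last_map)
qed

text \<open>Mapping by f and by its inverse carries chains to chains of the same length, so the two
  sets of lengths coincide.\<close>

lemma rk_iso:
  assumes f: "bij_betw f P Q" and iso: "\<And>x y. x \<in> P \<Longrightarrow> y \<in> P \<Longrightarrow> le x y \<longleftrightarrow> leQ (f x) (f y)"
    and "p \<in> P"
  shows "rk P le p = rk Q leQ (f p)"
proof -
  let ?g = "inv_into P f"
  have lt: "strict_lt le x y \<longleftrightarrow> strict_lt leQ (f x) (f y)" if "x \<in> P" "y \<in> P" for x y
    using iso that f by (auto simp: strict_lt_def bij_betw_def inj_on_eq_iff)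
  have g: "?g x \<in> P \<and> f (?g x) = x" if "x \<in> Q" for x
    using f that by (auto simp: bij_betw_def inv_into_into f_inv_into_f)
  have gf: "?g (f p) = p"
    using f \<open>p \<in> P\<close> by (auto simp: bij_betw_def inv_into_f_f)
  have "{length xs - 1 | xs. is_chain_to P le xs p} = {length xs - 1 | xs. is_chain_to Q leQ xs (f p)}"
    (is "?A = ?B")
  proof (intro equalityI subsetI)
    fix n assume "n \<in> ?A"
    then obtain xs where "n = length xs - 1" "is_chain_to P le xs p"
      by blast
    moreover from this have "is_chain_to Q leQ (map f xs) (f p)"
      using is_chain_to_map[of P le xs p f Q leQ] lt f by (auto simp: bij_betw_def)
    ultimately show "n \<in> ?B"
      by (metis (mono_tags, lifting) length_map mem_Collect_eq)
  next
    fix n assume "n \<in> ?B"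
    then obtain xs where "n = length xs - 1" "is_chain_to Q leQ xs (f p)"
      by blast
    moreover from this have "is_chain_to P le (map ?g xs) (?g (f p))"
      using is_chain_to_map[of Q leQ xs "f p" ?g P le] lt g by auto
    ultimately show "n \<in> ?A"
      by (metis (mono_tags, lifting) gf length_map mem_Collect_eq)
  qed
  then show ?thesis
    by (simp add: rk_def)
qed

subsection \<open>Order ideals and toggleability\<close>

lemma order_ideals_downD: "I \<in> order_ideals P le \<Longrightarrow> x \<in> I \<Longrightarrow> y \<in> P \<Longrightarrow> le y x \<Longrightarrow> y \<in> I"
  by (auto simp: order_ideals_def)

text \<open>U stands for the lower covers of p. An ideal is closed downwards, so containing U
  amounts to containing everything strictly below p. \<open>Tminus_eqI\<close> is the dual with
  upper covers.\<close>

lemma Tplus_eqI: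
  assumes "I \<in> order_ideals P le" "p \<in> P" "U \<subseteq> P"
    and "\<And>u. u \<in> U \<Longrightarrow> strict_lt le u p"
    and "\<And>y. y \<in> P \<Longrightarrow> strict_lt le y p \<Longrightarrow> \<exists>u\<in>U. le y u"
  shows "Tplus P le p I = of_bool (p \<notin> I \<and> U \<subseteq> I)"
proof -
  have "(p \<in> P - I \<and> (\<forall>y\<in>P - I. \<not> strict_lt le y p)) \<longleftrightarrow> p \<notin> I \<and> U \<subseteq> I"
    using assms order_ideals_downD[OF assms(1)] by blast
  then show ?thesis
    by (simp only: Tplus_def)
qed

lemma Tminus_eqI:
  assumes "I \<in> order_ideals P le" "p \<in> P" "U \<subseteq> P"
    and "\<And>u. u \<in> U \<Longrightarrow> strict_lt le p u"
    and "\<And>y. y \<in> P \<Longrightarrow> strict_lt le p y \<Longrightarrow> \<exists>u\<in>U. le u y"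
  shows "Tminus P le p I = of_bool (p \<in> I \<and> U \<inter> I = {})"
proof -
  have "(p \<in> I \<and> (\<forall>y\<in>I. \<not> strict_lt le p y)) \<longleftrightarrow> p \<in> I \<and> U \<inter> I = {}"
  proof -
    have "U \<inter> I \<noteq> {}" if "y \<in> I" "strict_lt le p y" for y
    proof -
      have "y \<in> P"
        using that(1) assms(1) by (auto simp: order_ideals_def)
      with assms(3,5) that order_ideals_downD[OF assms(1)] show ?thesis
        by blast
    qed
    with assms(4) show ?thesis
      by blast
  qed
  then show ?thesis
    by (simp only: Tminus_def)
qed

text \<open>The conclusion of the theorem as a property of a poset: it is proved for the concrete
  models and then transported along the isomorphism.\<close>

definition antichain_const :: "'a set \<Rightarrow> ('a \<Rightarrow> 'a \<Rightarrow> bool) \<Rightarrow> bool" where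
  "antichain_const P le \<longleftrightarrow> q_equiv P le (\<lambda>I. \<Sum>p\<in>P. Tminus P le p I)
     (\<lambda>I. (\<Sum>p\<in>P. qvar ^ rk P le p) / qint (rkP P le + 2))"

text \<open>Separates the value of the constant, verified after multiplying out
  \<open>qint (m + 2)\<close>, from the identity that holds ideal by ideal.\<close>

lemma antichain_constI:
  assumes "\<And>p. p \<in> P \<Longrightarrow> rk P le p = \<rho> p" and "Max (\<rho> ` P) = m"
    and "C * qint (m + 2) = (\<Sum>p\<in>P. qvar ^ \<rho> p)"
    and "\<And>I. I \<in> order_ideals P le \<Longrightarrow>
           (\<Sum>p\<in>P. Tminus P le p I) - C = (\<Sum>p\<in>P. c p * Tq P le p I)"
  shows "antichain_const P le"
proof -
  have "rkP P le = m"
    using assms(1,2) by (simp add: rkP_def)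
  moreover have "(\<Sum>p\<in>P. qvar ^ rk P le p) = C * qint (m + 2)"
    using assms(1,3) by simp
  ultimately show ?thesis
    using assms(4) qint_neq_0[of "m + 2"] by (auto simp: antichain_const_def q_equiv_def)
qed

lemma antichain_const_iso:
  fixes P :: "'a set" and Q :: "'b set"
  assumes Q: "antichain_const Q leQ" and f: "bij_betw f P Q"
    and iso: "\<And>x y. x \<in> P \<Longrightarrow> y \<in> P \<Longrightarrow> le x y \<longleftrightarrow> leQ (f x) (f y)"
  shows "antichain_const P le"
proof -
  have inj: "inj_on f P" and im: "f ` P = Q"
    using f by (auto simp: bij_betw_def)
  have lt: "strict_lt le x y \<longleftrightarrow> strict_lt leQ (f x) (f y)" if "x \<in> P" "y \<in> P" for x y
    using iso that inj by (auto simp: strict_lt_def inj_on_eq_iff)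
  have rk: "rk P le p = rk Q leQ (f p)" if "p \<in> P" for p
    using rk_iso[of f P Q le leQ p] f iso that by blast
  then have rkP: "rkP P le = rkP Q leQ"
    by (simp add: rkP_def im[symmetric] image_image cong: image_cong)
  have ideal: "f ` I \<in> order_ideals Q leQ" if "I \<in> order_ideals P le" for I
    using that iso unfolding im[symmetric] order_ideals_def by blast
  have mem: "f x \<in> f ` I \<longleftrightarrow> x \<in> I" if "I \<subseteq> P" "x \<in> P" for x I
    using inj that by (meson inj_on_image_mem_iff)
  have Tp: "Tplus Q leQ (f p) (f ` I) = Tplus P le p I" 
    and Tm: "Tminus Q leQ (f p) (f ` I) = Tminus P le p I"
    if "I \<in> order_ideals P le" "p \<in> P" for p I
  proof -
    have "I \<subseteq> P"
      using that by (auto simp: order_ideals_def)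
    have *: "(f p \<in> Q - f ` I \<and> (\<forall>y\<in>Q - f ` I. \<not> strict_lt leQ y (f p))) \<longleftrightarrow>
      p \<in> P - I \<and> (\<forall>y\<in>P - I. \<not> strict_lt le y p)"
      unfolding im[symmetric] using mem[OF \<open>I \<subseteq> P\<close>] lt \<open>p \<in> P\<close> by auto
    show "Tplus Q leQ (f p) (f ` I) = Tplus P le p I" 
      unfolding Tplus_def * ..
    have *: "(f p \<in> f ` I \<and> (\<forall>y\<in>f ` I. \<not> strict_lt leQ (f p) y)) \<longleftrightarrow>
      p \<in> I \<and> (\<forall>y\<in>I. \<not> strict_lt le p y)"
      using mem[OF \<open>I \<subseteq> P\<close>] lt \<open>p \<in> P\<close> \<open>I \<subseteq> P\<close> by (auto simp: subset_iff)
    show "Tminus Q leQ (f p) (f ` I) = Tminus P le p I"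
      unfolding Tminus_def * ..
  qed
  from Q obtain c where c: "\<And>I. I \<in> order_ideals Q leQ \<Longrightarrow> (\<Sum>p\<in>Q. Tminus Q leQ p I) -
      (\<Sum>p\<in>Q. qvar ^ rk Q leQ p) / qint (rkP Q leQ + 2) = (\<Sum>p\<in>Q. c p * Tq Q leQ p I)"
    by (auto simp: antichain_const_def q_equiv_def)
  have sum: "(\<Sum>p\<in>Q. h p) = (\<Sum>p\<in>P. h (f p))" for h :: "'b \<Rightarrow> ratfun"
    using sum.reindex_bij_betw[OF f, of h] by simp
  have "(\<Sum>p\<in>P. Tminus P le p I) - (\<Sum>p\<in>P. qvar ^ rk P le p) / qint (rkP P le + 2) =
      (\<Sum>p\<in>P. c (f p) * Tq P le p I)" if "I \<in> order_ideals P le" for I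
    using c[OF ideal[OF that]] Tp[OF that] Tm[OF that] rk rkP
    by (simp add: sum Tq_def cong: sum.cong)
  then show ?thesis
    unfolding antichain_const_def q_equiv_def by (intro exI[of _ "\<lambda>p. c (f p)"]) auto
qed

subsection \<open>Rectangles\<close>

lemma list_le_pair [simp]: "list_le [i, j] [k, l] \<longleftrightarrow> i \<le> k \<and> j \<le> l"
  by (simp add: list_le_def)

lemma strict_list_le_trans:
  "strict_lt list_le x y \<Longrightarrow> strict_lt list_le y z \<Longrightarrow> strict_lt list_le x z"
proof (unfold strict_lt_def list_le_def, elim conjE, intro conjI notI)
  assume xy: "list_all2 (\<le>) x y" and "x \<noteq> y" and yz: "list_all2 (\<le>) y z"
  show "list_all2 (\<le>) x z"
    using list_all2_trans[of "(\<le>)" "(\<le>)" "(\<le>)", OF _ xy yz] by auto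
  assume "x = z"
  with xy yz have "list_all2 (=) x y"
    by (auto simp: list_all2_conv_all_nth intro: antisym)
  with \<open>x \<noteq> y\<close> show False
    by (simp add: list.rel_eq)
qed

lemma strict_list_le_sum_list: "strict_lt list_le x y \<Longrightarrow> sum_list x < sum_list y"
proof -
  have *: "list_all2 (\<le>) x y \<Longrightarrow> sum_list x \<le> sum_list y \<and> (sum_list x = sum_list y \<longrightarrow> x = y)"
    by (induction rule: list_all2_induct) auto
  show "strict_lt list_le x y \<Longrightarrow> sum_list x < sum_list y"
    using * by (auto simp: strict_lt_def list_le_def less_le)
qed

text \<open>The coordinate sum is strictly monotone, so it is the rank up to the shift k: k = 2 for
  pairs starting at \<open>[1, 1]\<close>, and k = 1 for roots, where the sum is the height.\<close>

lemma rk_list_le: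
  assumes "\<And>p. p \<in> P \<Longrightarrow> k \<le> sum_list p"
    and "\<And>p. p \<in> P \<Longrightarrow> sum_list p \<noteq> k \<Longrightarrow> \<exists>y\<in>P. list_le y p \<and> Suc (sum_list y) = sum_list p"
    and "p \<in> P"
  shows "rk P list_le p = sum_list p - k"
proof (rule rk_eqI)
  fix x y assume "x \<in> P" "y \<in> P" "strict_lt list_le x y"
  with assms(1) show "sum_list x - k < sum_list y - k"
    by (simp add: diff_less_mono strict_list_le_sum_list)
next
  fix p assume p: "p \<in> P" "sum_list p - k \<noteq> 0"
  then obtain y where y: "y \<in> P" "list_le y p" "Suc (sum_list y) = sum_list p"
    using assms(2)[of p] by auto
  with assms(1)[of y] have "strict_lt list_le y p \<and> Suc (sum_list y - k) = sum_list p - k"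
    by (auto simp: strict_lt_def)
  with y(1) show "\<exists>y\<in>P. strict_lt list_le y p \<and> Suc (sum_list y - k) = sum_list p - k"
    by blast
qed (use strict_list_le_trans \<open>p \<in> P\<close> in blast)+

section \<open>Coordinates, corners and weights of rectangles\<close>

lemma rect_mem [simp]: "[i, j] \<in> rect_set a b \<longleftrightarrow> 1 \<le> i \<and> i \<le> a \<and> 1 \<le> j \<and> j \<le> b"
  by (auto simp: rect_set_def)

lemma rectE:
  assumes "p \<in> rect_set a b"
  obtains i j where "p = [i, j]" "1 \<le> i" "i \<le> a" "1 \<le> j" "j \<le> b"
  using assms by (auto simp: rect_set_def)

lemma sum_rect: "(\<Sum>p\<in>rect_set a b. h p) = (\<Sum>i<a. \<Sum>j<b. h [Suc i, Suc j])"
proof -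
  have "bij_betw (\<lambda>(i, j). [Suc i, Suc j]) ({..<a} \<times> {..<b}) (rect_set a b)"
  proof (rule bij_betw_imageI)
    show "inj_on (\<lambda>(i, j). [Suc i, Suc j]) ({..<a} \<times> {..<b})"
      by (auto simp: inj_on_def)
    have "p \<in> (\<lambda>(i, j). [Suc i, Suc j]) ` ({..<a} \<times> {..<b})" if "p \<in> rect_set a b" for p
    proof -
      from that obtain i j where "p = [i, j]" "1 \<le> i" "i \<le> a" "1 \<le> j" "j \<le> b"
        by (auto simp: rect_set_def)
      then show ?thesis
        by (intro image_eqI[of _ _ "(i - 1, j - 1)"]) auto
    qed
    then show "(\<lambda>(i, j). [Suc i, Suc j]) ` ({..<a} \<times> {..<b}) = rect_set a b"
      by (auto simp: rect_set_def)
  qed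
  from sum.reindex_bij_betw[OF this, of h] show ?thesis
    by (simp add: sum.cartesian_product case_prod_unfold)
qed

text \<open>The corners of the boundary path of an ideal alternate between consecutive steps sharing a
  coordinate, so a corner weight of the form \<^term>\<open>A i + B j\<close> telescopes; here
  \<^term>\<open>x i j\<close> is the indicator of the ideal, extended by 1 along the axes.\<close>
lemma corner_sum:
  fixes x :: "nat \<Rightarrow> nat \<Rightarrow> 'f :: comm_ring_1"
  assumes "1 \<le> a" "1 \<le> b"
    and x0: "\<And>j. x 0 j = 1" "\<And>i. x i 0 = 1"
    and x1: "\<And>j. x (Suc a) (Suc j) = 0" "\<And>i. x (Suc i) (Suc b) = 0"
    and F0: "A 0 + B b = 0" "A a + B 0 = 0"
  shows "(\<Sum>i<a. \<Sum>j<b. (A i + B j) * (x i (Suc j) * x (Suc i) j - x (Suc i) (Suc j)))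
    - (\<Sum>i<a. \<Sum>j<b. (A (Suc i) + B (Suc j)) * (x (Suc i) (Suc j) - x (Suc (Suc i)) (Suc j)
          - x (Suc i) (Suc (Suc j)) + x (Suc (Suc i)) (Suc j) * x (Suc i) (Suc (Suc j)))) = A 0 + B 0"
proof -
  \<comment> \<open>When x is the indicator of an ideal, \<open>G i j\<close> tells whether box
    (i+1, j+1) can be added and \<open>H i j\<close> (for positive i, j) whether box (i, j) can be
    removed. Both thus sit at the lattice point (i, j) where the boundary path turns.\<close>
  define G where "G i j = x i (Suc j) * x (Suc i) j - x (Suc i) (Suc j)" for i j
  define H where "H i j = x i j - x (Suc i) j - x i (Suc j) + x (Suc i) j * x i (Suc j)" for i j
  define F where "F i j = A i + B j" for i j
  have "(\<Sum>i<Suc a. \<Sum>j<Suc b. F i j * G i j) = (\<Sum>i<a. \<Sum>j<b. F i j * G i j)"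
  proof -
    \<comment> \<open>On the far border \<open>x1\<close> annihilates \<open>G\<close> except at (0,
      b) and (a, 0), the two ends of the path; there the weight itself is zero by
      \<open>F0\<close>.\<close>
    have "F i b * G i b = 0" if "i < a" for i
      using F0 x1 by (cases i) (auto simp: F_def G_def)
    moreover have "F a j * G a j = 0" for j
      using F0 x1 \<open>1 \<le> a\<close> by (cases j) (auto simp: F_def G_def add.commute)
    ultimately show ?thesis
      by simp
  qed
  moreover have "(\<Sum>i<Suc a. \<Sum>j<Suc b. F i j * H i j) = (\<Sum>i<a. \<Sum>j<b. F (Suc i) (Suc j) * H (Suc i) (Suc j))"
    by (simp add: sum.lessThan_Suc_shift H_def x0 del: sum.lessThan_Suc)
  moreover have "(\<Sum>i<Suc a. \<Sum>j<Suc b. F i j * G i j) - (\<Sum>i<Suc a. \<Sum>j<Suc b. F i j * H i j) = A 0 + B 0"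
  proof -
    \<comment> \<open>The products cancel in G - H and leave a mixed second difference, linear in x.
      Against \<open>A i\<close> it is summed along rows and against \<open>B j\<close> along
      columns, and only row 0 and column 0 contribute.\<close>
    define \<Delta> where "\<Delta> i j = (x (Suc i) j - x i j) - (x (Suc i) (Suc j) - x i (Suc j))" for i j
    have row: "(\<Sum>j<Suc b. \<Delta> i j) = (if i = 0 then 1 else 0)" for i
      using sum_lessThan_telescope'[of "\<lambda>j. x (Suc i) j - x i j" "Suc b"]
      by (cases i) (simp_all add: \<Delta>_def x0 x1)
    have \<Delta>': "\<Delta> i j = (x i (Suc j) - x i j) - (x (Suc i) (Suc j) - x (Suc i) j)" for i j
      by (simp add: \<Delta>_def)
    have col: "(\<Sum>i<Suc a. \<Delta> i j) = (if j = 0 then 1 else 0)" for j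
      using sum_lessThan_telescope'[of "\<lambda>i. x i (Suc j) - x i j" "Suc a"]
      by (cases j) (simp_all add: \<Delta>' x0 x1)
    have "(\<Sum>i<Suc a. \<Sum>j<Suc b. F i j * G i j) - (\<Sum>i<Suc a. \<Sum>j<Suc b. F i j * H i j)
       = (\<Sum>i<Suc a. \<Sum>j<Suc b. A i * \<Delta> i j + B j * \<Delta> i j)"
      unfolding sum_subtractf[symmetric]
      by (intro sum.cong refl) (simp add: F_def G_def H_def \<Delta>_def algebra_simps)
    also have "\<dots> = (\<Sum>i<Suc a. A i * (\<Sum>j<Suc b. \<Delta> i j)) + (\<Sum>j<Suc b. B j * (\<Sum>i<Suc a. \<Delta> i j))"
      unfolding sum.distrib sum_distrib_left by (subst (2) sum.swap) (rule refl)
    also have "\<dots> = A 0 + B 0"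
      unfolding row col by (simp add: if_distrib[of "(*) _"] del: sum.lessThan_Suc cong: if_cong)
    finally show ?thesis .
  qed
  ultimately show ?thesis
    by (simp add: F_def G_def H_def)
qed

lemma rk_rect: "p \<in> rect_set a b \<Longrightarrow> rk (rect_set a b) list_le p = sum_list p - 2"
proof (rule rk_list_le)
  fix p assume p: "p \<in> rect_set a b" "sum_list p \<noteq> 2"
  then obtain i j where ij: "p = [i, j]" "1 \<le> i" "i \<le> a" "1 \<le> j" "j \<le> b"
    by (auto simp: rect_set_def)
  show "\<exists>y\<in>rect_set a b. list_le y p \<and> Suc (sum_list y) = sum_list p"
  proof (cases "i = 1")
    case True
    with ij p(2) show ?thesis
      by (intro bexI[of _ "[i, j - 1]"]) auto
  next
    case False
    with ij show ?thesis
      by (intro bexI[of _ "[i - 1, j]"]) auto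
  qed
qed (auto simp: rect_set_def)

lemma Max_rk_rect:
  assumes "1 \<le> a" "1 \<le> b"
  shows "Max ((\<lambda>p. sum_list p - 2) ` rect_set a b) = a + b - 2"
proof (rule Max_eqI)
  show "finite ((\<lambda>p. sum_list p - 2) ` rect_set a b)"
    by (rule finite_subset[of _ "{..a + b}"]) (auto simp: rect_set_def)
  show "a + b - 2 \<in> (\<lambda>p. sum_list p - 2) ` rect_set a b"
    using assms by (intro image_eqI[of _ _ "[a, b]"]) auto
qed (auto simp: rect_set_def)

lemma antichain_const_rect:
  assumes "1 \<le> a" "1 \<le> b"
  shows "antichain_const (rect_set a b) list_le"
proof -
  \<comment> \<open>The recursions \<open>A (Suc i) = qvar * A i\<close> and
    \<open>B (Suc j) = qvar * B j - 1\<close> give \<open>AB\<close>. The multiple of q^j in B is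
    chosen to make the weight vanish at (a, 0), and \<open>A0\<close> to make it vanish at (0,
    b).\<close>
  define A0 where "A0 = qint b / (1 - qvar ^ (a + b))"
  define A where "A i = qvar ^ i * A0" for i
  define B where "B j = - (qvar ^ j) * (qvar ^ a * A0) - qint j" for j
  have nz: "1 - qvar ^ (a + b) \<noteq> 0"
    using qvar_power_neq_1[of "a + b"] assms by simp
  have AB: "1 - qvar * (A i + B j) = - (A (Suc i) + B (Suc j))" for i j
    by (simp add: A_def B_def qint_Suc_shift algebra_simps)
  have "A0 * (1 - qvar ^ (a + b)) = qint b"
    using nz by (simp add: A0_def)
  then have F0: "A 0 + B b = 0" "A a + B 0 = 0"
    by (simp_all add: A_def B_def power_add algebra_simps)
  define c where "c p = - (A (p ! 0 - 1) + B (p ! 1 - 1))" for p :: "nat list"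
  show ?thesis
  proof (rule antichain_constI)
    \<comment> \<open>The constant is [a][b]/[a+b], whose numerator is the rank generating function
      of a product of two chains.\<close>
    show "(A 0 + B 0) * qint (a + b - 2 + 2) = (\<Sum>p\<in>rect_set a b. qvar ^ (sum_list p - 2))"
    proof -
      have "(A 0 + B 0) * qint (a + b) = A0 * (1 - qvar ^ a) * qint (a + b)"
        by (simp add: A_def B_def algebra_simps)
      also have "\<dots> = A0 * ((1 - qvar) * qint (a + b)) * qint a"
        by (simp add: qint_mult[of a, symmetric])
      also have "\<dots> = qint a * qint b"
        unfolding qint_mult using nz by (simp add: A0_def)
      also have "\<dots> = (\<Sum>p\<in>rect_set a b. qvar ^ (sum_list p - 2))"
        by (simp add: sum_rect qint_def sum_product power_add)
      finally have "(A 0 + B 0) * qint (a + b) = (\<Sum>p\<in>rect_set a b. qvar ^ (sum_list p - 2))" .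
      moreover have "a + b - 2 + 2 = a + b"
        using assms by simp
      ultimately show ?thesis
        by (simp only:)
    qed
  next
    fix I assume I: "I \<in> order_ideals (rect_set a b) list_le"
    define x :: "nat \<Rightarrow> nat \<Rightarrow> ratfun" where "x i j = of_bool (i = 0 \<or> j = 0 \<or> [i, j] \<in> I)" for i j
    have sub: "I \<subseteq> rect_set a b"
      using I by (simp add: order_ideals_def)
    then have x1: "x (Suc a) (Suc j) = 0" "x (Suc i) (Suc b) = 0" for i j
      by (auto simp: x_def)
    have down: "[k, l] \<in> I" if "[i, j] \<in> I" "1 \<le> k" "k \<le> i" "1 \<le> l" "l \<le> j" for i j k l
      using order_ideals_downD[OF I that(1), of "[k, l]"] that sub by force
    have Tp: "Tplus (rect_set a b) list_le [Suc i, Suc j] I = x i (Suc j) * x (Suc i) j - x (Suc i) (Suc j)"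
      if "i < a" "j < b" for i j
    proof -
      \<comment> \<open>Intersecting with the rectangle discards neighbours on the axes, in
        agreement with the value 1 that x takes there.\<close>
      have "Tplus (rect_set a b) list_le [Suc i, Suc j] I =
         of_bool ([Suc i, Suc j] \<notin> I \<and> {[i, Suc j], [Suc i, j]} \<inter> rect_set a b \<subseteq> I)"
      proof (rule Tplus_eqI[OF I])
        fix y assume "y \<in> rect_set a b" "strict_lt list_le y [Suc i, Suc j]"
        moreover from this obtain k l where "y = [k, l]" "1 \<le> k" "1 \<le> l"
          by (elim rectE)
        moreover from calculation have "k \<le> i \<or> l \<le> j"
          by (auto simp: strict_lt_def)
        ultimately show "\<exists>u\<in>{[i, Suc j], [Suc i, j]} \<inter> rect_set a b. list_le y u"
          using that by (auto simp: strict_lt_def Int_insert_left)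
      qed (use that in \<open>auto simp: strict_lt_def\<close>)
      then show ?thesis
        using that down[of "Suc i" "Suc j" i "Suc j"] down[of "Suc i" "Suc j" "Suc i" j]
        by (auto simp: x_def Int_insert_left)
    qed
    have Tm: "Tminus (rect_set a b) list_le [Suc i, Suc j] I =
        x (Suc i) (Suc j) - x (Suc (Suc i)) (Suc j)
          - x (Suc i) (Suc (Suc j)) + x (Suc (Suc i)) (Suc j) * x (Suc i) (Suc (Suc j))"
      if "i < a" "j < b" for i j
    proof -
      have "Tminus (rect_set a b) list_le [Suc i, Suc j] I =
         of_bool ([Suc i, Suc j] \<in> I \<and> ({[Suc (Suc i), Suc j], [Suc i, Suc (Suc j)]} \<inter> rect_set a b) \<inter> I = {})"
      proof (rule Tminus_eqI[OF I])
        fix y assume "y \<in> rect_set a b" "strict_lt list_le [Suc i, Suc j] y"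
        moreover from this obtain k l where "y = [k, l]" "k \<le> a" "l \<le> b"
          by (elim rectE)
        moreover from calculation have "Suc (Suc i) \<le> k \<or> Suc (Suc j) \<le> l"
          by (auto simp: strict_lt_def)
        ultimately show "\<exists>u\<in>{[Suc (Suc i), Suc j], [Suc i, Suc (Suc j)]} \<inter> rect_set a b. list_le u y"
          using that by (auto simp: strict_lt_def Int_insert_left)
      qed (use that in \<open>auto simp: strict_lt_def\<close>)
      then show ?thesis
        using that sub down[of "Suc (Suc i)" "Suc j" "Suc i" "Suc j"]
          down[of "Suc i" "Suc (Suc j)" "Suc i" "Suc j"]
        by (auto simp: x_def Int_insert_left)
    qed
    have "(\<Sum>p\<in>rect_set a b. Tminus (rect_set a b) list_le p I - c p * Tq (rect_set a b) list_le p I) =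
      (\<Sum>i<a. \<Sum>j<b. (A i + B j) * (x i (Suc j) * x (Suc i) j - x (Suc i) (Suc j)) -
        (A (Suc i) + B (Suc j)) * (x (Suc i) (Suc j) - x (Suc (Suc i)) (Suc j)
          - x (Suc i) (Suc (Suc j)) + x (Suc (Suc i)) (Suc j) * x (Suc i) (Suc (Suc j))))"
      unfolding sum_rect
    proof (intro sum.cong refl)
      fix i j assume "i \<in> {..<a}" "j \<in> {..<b}"
      have alg: "m - - F * (p - qvar * m) = F * p - F' * m" if "1 - qvar * F = - F'" for m p F F' :: ratfun
      proof -
        have "m - - F * (p - qvar * m) = F * p + (1 - qvar * F) * m"
          by (simp add: algebra_simps)
        with that show ?thesis
          by simp
      qed
      show "Tminus (rect_set a b) list_le [Suc i, Suc j] I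
          - c [Suc i, Suc j] * Tq (rect_set a b) list_le [Suc i, Suc j] I =
        (A i + B j) * (x i (Suc j) * x (Suc i) j - x (Suc i) (Suc j)) -
        (A (Suc i) + B (Suc j)) * (x (Suc i) (Suc j) - x (Suc (Suc i)) (Suc j)
          - x (Suc i) (Suc (Suc j)) + x (Suc (Suc i)) (Suc j) * x (Suc i) (Suc (Suc j)))"
      proof -
        have "c [Suc i, Suc j] = - (A i + B j)" "i < a" "j < b"
          using \<open>i \<in> _\<close> \<open>j \<in> _\<close> by (simp_all add: c_def)
        then show ?thesis
          by (simp only: Tq_def Tm Tp alg[OF AB])
      qed
    qed
    also have "\<dots> = A 0 + B 0"
      unfolding sum_subtractf
      by (rule corner_sum) (use assms in \<open>simp_all add: x1 F0\<close>, simp_all add: x_def)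
    finally show "(\<Sum>p\<in>rect_set a b. Tminus (rect_set a b) list_le p I) - (A 0 + B 0)
      = (\<Sum>p\<in>rect_set a b. c p * Tq (rect_set a b) list_le p I)"
      by (simp add: sum_subtractf algebra_simps)
  qed (use rk_rect Max_rk_rect assms in auto)
qed

subsection \<open>Shifted staircases\<close>

lemma stair_mem [simp]: "[i, j] \<in> stair_set n \<longleftrightarrow> 1 \<le> i \<and> i \<le> j \<and> j \<le> n"
  by (auto simp: stair_set_def)

lemma stair_subset_rect: "stair_set n \<subseteq> rect_set n n"
  by (auto simp: stair_set_def rect_set_def)

definition diag_set :: "nat \<Rightarrow> nat list set" where
  "diag_set n = {[i, i] | i. 1 \<le> i \<and> i \<le> n}"

lemma finite_rect: "finite (rect_set a b)"
proof -
  have "rect_set a b = (\<lambda>(i, j). [i, j]) ` ({1..a} \<times> {1..b})"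
    by (auto simp: rect_set_def image_def)
  then show ?thesis
    by simp
qed

lemma finite_stair: "finite (stair_set n)"
  using finite_rect stair_subset_rect by (rule finite_subset[rotated])

lemma diag_subset_stair: "diag_set n \<subseteq> stair_set n"
  by (auto simp: diag_set_def)

lemma sum_diag: "(\<Sum>p\<in>diag_set n. h p) = (\<Sum>i<n. h [Suc i, Suc i])"
proof -
  have "diag_set n = (\<lambda>i. [Suc i, Suc i]) ` {..<n}"
  proof -
    have "[i, i] \<in> (\<lambda>i. [Suc i, Suc i]) ` {..<n}" if "1 \<le> i" "i \<le> n" for i
      using that by (intro image_eqI[of _ _ "i - 1"]) auto
    then show ?thesis
      by (auto simp: diag_set_def)
  qed
  then show ?thesis
    by (simp add: sum.reindex inj_on_def)
qed

text \<open>Inclusion-exclusion: the square is the union of the staircase and its transpose, which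
  meet in the diagonal.\<close>

lemma sum_rect_fold:
  fixes h :: "nat list \<Rightarrow> 'b :: ab_group_add"
  shows "(\<Sum>p\<in>rect_set n n. h p) + (\<Sum>p\<in>diag_set n. h p) = (\<Sum>p\<in>stair_set n. h p + h (rev p))"
proof -
  let ?R = "rev ` stair_set n"
  have R: "?R = {[j, i] | i j. 1 \<le> i \<and> i \<le> j \<and> j \<le> n}"
    by (force simp: stair_set_def)
  have "rect_set n n = stair_set n \<union> ?R"
    unfolding R by (auto simp: stair_set_def rect_set_def)
  moreover have "diag_set n = stair_set n \<inter> ?R"
    unfolding R by (auto simp: stair_set_def diag_set_def)
  ultimately have "(\<Sum>p\<in>rect_set n n. h p) + (\<Sum>p\<in>diag_set n. h p) = (\<Sum>p\<in>stair_set n. h p) + (\<Sum>p\<in>?R. h p)"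
    using sum.union_inter[of "stair_set n" ?R h] finite_stair by simp
  also have "(\<Sum>p\<in>?R. h p) = (\<Sum>p\<in>stair_set n. h (rev p))"
    by (simp add: sum.reindex)
  finally show ?thesis
    by (simp add: sum.distrib)
qed

lemma rk_stair: "p \<in> stair_set n \<Longrightarrow> rk (stair_set n) list_le p = sum_list p - 2"
proof (rule rk_list_le)
  fix p assume p: "p \<in> stair_set n" "sum_list p \<noteq> 2"
  then obtain i j where ij: "p = [i, j]" "1 \<le> i" "i \<le> j" "j \<le> n"
    by (auto simp: stair_set_def)
  show "\<exists>y\<in>stair_set n. list_le y p \<and> Suc (sum_list y) = sum_list p"
  proof (cases "i = 1")
    case True
    with ij p(2) show ?thesis
      by (intro bexI[of _ "[i, j - 1]"]) auto
  next
    case False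
    with ij show ?thesis
      by (intro bexI[of _ "[i - 1, j]"]) auto
  qed
qed (auto simp: stair_set_def)

lemma Max_rk_stair:
  assumes "1 \<le> n"
  shows "Max ((\<lambda>p. sum_list p - 2) ` stair_set n) = n + n - 2"
proof (rule Max_eqI)
  show "n + n - 2 \<in> (\<lambda>p. sum_list p - 2) ` stair_set n"
    using assms by (intro image_eqI[of _ _ "[n, n]"]) auto
qed (use finite_stair in \<open>auto simp: stair_set_def\<close>)

text \<open>The only neighbours of \<open>[Suc i, Suc i]\<close> in the staircase are
  \<open>[i, Suc i]\<close> below and \<open>[Suc i, Suc (Suc i)]\<close> above. It can be toggled
  exactly when the lower one is in I (or i = 0) and the upper one is not. These neighbours form a
  chain, of which I contains an initial part, so the sum telescopes.\<close>

lemma diag_toggle_sum: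
  assumes I: "I \<in> order_ideals (stair_set n) list_le" and "1 \<le> n"
  shows "(\<Sum>p\<in>diag_set n. Tplus (stair_set n) list_le p I + Tminus (stair_set n) list_le p I) = 1"
proof -
  define e :: "nat \<Rightarrow> ratfun" where "e i = of_bool (i = 0 \<or> [i, Suc i] \<in> I)" for i
  have sub: "I \<subseteq> stair_set n"
    using I by (simp add: order_ideals_def)
  have down: "[k, l] \<in> I" if "[i, j] \<in> I" "1 \<le> k" "k \<le> l" "k \<le> i" "l \<le> j" for i j k l
    using order_ideals_downD[OF I that(1), of "[k, l]"] that sub by force
  have "Tplus (stair_set n) list_le [Suc i, Suc i] I + Tminus (stair_set n) list_le [Suc i, Suc i] I
      = e i - e (Suc i)" if "i < n" for i
  proof -
    have "Tplus (stair_set n) list_le [Suc i, Suc i] I =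
       of_bool ([Suc i, Suc i] \<notin> I \<and> {[i, Suc i]} \<inter> stair_set n \<subseteq> I)"
      using that by (intro Tplus_eqI[OF I]) (auto simp: strict_lt_def stair_set_def)
    moreover have "Tminus (stair_set n) list_le [Suc i, Suc i] I =
       of_bool ([Suc i, Suc i] \<in> I \<and> ({[Suc i, Suc (Suc i)]} \<inter> stair_set n) \<inter> I = {})"
      using that by (intro Tminus_eqI[OF I]) (auto simp: strict_lt_def stair_set_def)
    ultimately show ?thesis
      using that sub down[of "Suc i" "Suc i" i "Suc i"] down[of "Suc i" "Suc (Suc i)" "Suc i" "Suc i"]
      by (auto simp: e_def)
  qed
  then have "(\<Sum>p\<in>diag_set n. Tplus (stair_set n) list_le p I + Tminus (stair_set n) list_le p I)
      = (\<Sum>i<n. e i - e (Suc i))"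
    unfolding sum_diag by (intro sum.cong) auto
  also have "\<dots> = 1"
    unfolding sum_lessThan_telescope' using \<open>1 \<le> n\<close> sub by (auto simp: e_def)
  finally show ?thesis .
qed

definition unfold_ideal :: "nat list set \<Rightarrow> nat list set" where
  "unfold_ideal I = I \<union> rev ` I"

text \<open>The map from (i, j) to (min, max) folds the square onto the staircase, preserves
  membership in the unfolded ideal, and preserves strict comparison with a staircase element. An
  element obstructing a toggle in the square therefore folds to one in the staircase. Transposition
  is an automorphism fixing the unfolded ideal, which settles the reversed elements.\<close>

lemma unfold_ideal:
  assumes I: "I \<in> order_ideals (stair_set n) list_le"
  shows "unfold_ideal I \<in> order_ideals (rect_set n n) list_le"
    and "p \<in> stair_set n \<Longrightarrow>
      Tplus (rect_set n n) list_le p (unfold_ideal I) = Tplus (stair_set n) list_le p I"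
    and "p \<in> stair_set n \<Longrightarrow>
      Tminus (rect_set n n) list_le p (unfold_ideal I) = Tminus (stair_set n) list_le p I"
    and "p \<in> stair_set n \<Longrightarrow>
      Tplus (rect_set n n) list_le (rev p) (unfold_ideal I) = Tplus (stair_set n) list_le p I"
    and "p \<in> stair_set n \<Longrightarrow>
      Tminus (rect_set n n) list_le (rev p) (unfold_ideal I) = Tminus (stair_set n) list_le p I"
proof -
  let ?J = "unfold_ideal I" and ?R = "rect_set n n" and ?S = "stair_set n"
  have sub: "I \<subseteq> ?S"
    using I by (simp add: order_ideals_def)
  have down: "[k, l] \<in> I" if "[i, j] \<in> I" "1 \<le> k" "k \<le> l" "k \<le> i" "l \<le> j" for i j k l
    using order_ideals_downD[OF I that(1), of "[k, l]"] that sub by force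
  have mem: "[i, j] \<in> ?J \<longleftrightarrow> [min i j, max i j] \<in> I" for i j
  proof -
    have "[i, j] \<in> rev ` I \<longleftrightarrow> [j, i] \<in> I"
      using inj_image_mem_iff[of rev "[j, i]" I] by simp
    then show ?thesis
      using sub by (cases "i \<le> j") (auto simp: unfold_ideal_def min_def max_def)
  qed
  have JR: "?J \<subseteq> ?R"
    using sub by (fastforce simp: unfold_ideal_def stair_set_def rect_set_def)
  show J: "?J \<in> order_ideals ?R list_le"
    unfolding order_ideals_def
  proof (intro CollectI conjI JR ballI impI)
    fix x y assume "x \<in> ?J" "y \<in> ?R" "list_le y x"
    moreover from this JR obtain i j where "x = [i, j]"
      by (meson rectE subsetD)
    moreover from \<open>y \<in> ?R\<close> obtain k l where "y = [k, l]" "1 \<le> k" "1 \<le> l"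
      by (elim rectE)
    moreover from calculation have "min k l \<le> min i j" "max k l \<le> max i j"
      by auto
    ultimately show "y \<in> ?J"
      using down[of "min i j" "max i j" "min k l" "max k l"] by (simp add: mem)
  qed
  have rev_lt: "strict_lt list_le (rev x) (rev y) \<longleftrightarrow> strict_lt list_le x y" for x y
    by (auto simp: strict_lt_def list_le_def list_all2_rev)
  have rev_J: "rev x \<in> ?J \<longleftrightarrow> x \<in> ?J" for x
    using inj_image_mem_iff[of rev x I] inj_image_mem_iff[of rev "rev x" I] by (auto simp: unfold_ideal_def)
  have rev_R: "rev x \<in> ?R \<longleftrightarrow> x \<in> ?R" for x
  proof -
    have "rev x \<in> ?R" if "x \<in> ?R" for x
      using that by (auto elim!: rectE)
    from this[of x] this[of "rev x"] show ?thesis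
      by auto
  qed
  have Tp: "Tplus ?R list_le p ?J = Tplus ?S list_le p I"
   and Tm: "Tminus ?R list_le p ?J = Tminus ?S list_le p I" if pS: "p \<in> ?S" for p
  proof -
    obtain i j where p: "p = [i, j]" "1 \<le> i" "i \<le> j" "j \<le> n"
      using pS by (auto simp: stair_set_def)
    have SR: "x \<in> ?R \<and> (x \<in> ?J \<longleftrightarrow> x \<in> I)" if "x \<in> ?S" for x
      using that mem by (auto simp: stair_set_def)
    have fold: "\<exists>z\<in>?S. (z \<in> I \<longleftrightarrow> y \<in> ?J) \<and> (strict_lt list_le y p \<longrightarrow> strict_lt list_le z p)
        \<and> (strict_lt list_le p y \<longrightarrow> strict_lt list_le p z)" if "y \<in> ?R" for y
    proof -
      from \<open>y \<in> ?R\<close> obtain k l where y: "y = [k, l]" "1 \<le> k" "k \<le> n" "1 \<le> l" "l \<le> n"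
        by (rule rectE)
      then show ?thesis
        using p by (intro bexI[of _ "[min k l, max k l]"]) (auto simp: mem strict_lt_def)
    qed
    have *: "(p \<in> ?R - ?J \<and> (\<forall>y\<in>?R - ?J. \<not> strict_lt list_le y p)) \<longleftrightarrow>
      p \<in> ?S - I \<and> (\<forall>y\<in>?S - I. \<not> strict_lt list_le y p)"
      using SR fold pS by blast
    show "Tplus ?R list_le p ?J = Tplus ?S list_le p I"
      unfolding Tplus_def * ..
    have *: "(p \<in> ?J \<and> (\<forall>y\<in>?J. \<not> strict_lt list_le p y)) \<longleftrightarrow>
      p \<in> I \<and> (\<forall>y\<in>I. \<not> strict_lt list_le p y)"
      using SR fold pS JR sub by blast
    show "Tminus ?R list_le p ?J = Tminus ?S list_le p I"
      unfolding Tminus_def * ..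
  qed
  have all_rev: "(\<forall>x\<in>A. Q x) \<longleftrightarrow> (\<forall>x\<in>A. Q (rev x))" if "\<And>x. rev x \<in> A \<longleftrightarrow> x \<in> A" for A and Q :: "nat list \<Rightarrow> bool"
    using that by (metis rev_rev_ident)
  show "Tplus ?R list_le p ?J = Tplus ?S list_le p I"
    and "Tminus ?R list_le p ?J = Tminus ?S list_le p I" if "p \<in> ?S"
    using Tp Tm that by blast+
  have Tp_rev: "Tplus ?R list_le (rev p) ?J = Tplus ?R list_le p ?J" for p
    unfolding Tplus_def by (subst all_rev) (simp_all add: rev_lt rev_J rev_R)
  have Tm_rev: "Tminus ?R list_le (rev p) ?J = Tminus ?R list_le p ?J" for p
    unfolding Tminus_def by (subst all_rev) (simp_all add: rev_lt rev_J rev_R)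
  show "Tplus ?R list_le (rev p) ?J = Tplus ?S list_le p I"
    and "Tminus ?R list_le (rev p) ?J = Tminus ?S list_le p I" if "p \<in> ?S"
    using Tp Tm that Tp_rev Tm_rev by auto
qed

lemma qint_double: "(1 + qvar) * (\<Sum>i<n. qvar ^ (2 * i)) = qint (n + n)"
  by (induction n) (simp_all add: qint_def algebra_simps power_add mult_2_right)

text \<open>Unfolding an ideal of the staircase to a symmetric ideal of the square counts every
  antichain twice, except for its elements on the diagonal; and exactly one diagonal element
  can be toggled.\<close>
lemma antichain_const_stair:
  assumes "1 \<le> n"
  shows "antichain_const (stair_set n) list_le"
proof -
  let ?R = "rect_set n n" and ?S = "stair_set n" and ?D = "diag_set n"
  have n2: "n + n - 2 + 2 = n + n"
    using assms by simp
  have rkP: "rkP ?R list_le = n + n - 2"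
    using Max_rk_rect[OF assms assms] rk_rect by (simp add: rkP_def)
  define C where "C = (\<Sum>p\<in>?R. qvar ^ (sum_list p - 2)) / qint (n + n)"
  obtain c where c: "\<And>I. I \<in> order_ideals ?R list_le \<Longrightarrow>
      (\<Sum>p\<in>?R. Tminus ?R list_le p I) - C = (\<Sum>p\<in>?R. c p * Tq ?R list_le p I)"
    using antichain_const_rect[OF assms assms] assms
    unfolding antichain_const_def q_equiv_def rkP n2 C_def by (auto simp: rk_rect)
  \<comment> \<open>Since \<open>Tplus + Tminus - Tq\<close> is (1+q) \<open>Tminus\<close>, the
    unit sum of diagonal toggles makes the diagonal sum of \<open>Tminus\<close> equivalent to
    r.\<close>
  define r where "r = 1 / (1 + qvar)"
  have r: "r * (1 + qvar) = 1"
    using one_plus_qvar_power_neq_0[of 1] by (simp add: r_def)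
  have qint0: "qint (n + n) \<noteq> 0"
    using assms by (intro qint_neq_0) simp
  \<comment> \<open>Folding the identity of the square gives \<open>c p + c (rev p)\<close>, less
    \<open>c p\<close> on the diagonal. Eliminating the diagonal sum of \<open>Tminus\<close>
    subtracts r there as well, and the factor 2 is divided out.\<close>
  define d where "d p = (c p + c (rev p) - (if p \<in> ?D then c p + r else 0)) / 2" for p
  show ?thesis
  proof (rule antichain_constI)
    \<comment> \<open>Both summands are rank sums over \<open>qint (n + n)\<close>: C over the
      square, r over the diagonal. Together they count the staircase twice, so its rank sum need not
      be put in closed form.\<close>
    have "(C + r) * qint (n + n) = (\<Sum>p\<in>?R. qvar ^ (sum_list p - 2)) + r * ((1 + qvar) * (\<Sum>i<n. qvar ^ (2 * i)))"
      using qint0 unfolding qint_double by (simp add: C_def distrib_right)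
    also have "r * ((1 + qvar) * (\<Sum>i<n. qvar ^ (2 * i))) = (\<Sum>p\<in>?D. qvar ^ (sum_list p - 2))"
      unfolding mult.assoc[symmetric] r by (simp add: sum_diag mult_2)
    also have "(\<Sum>p\<in>?R. qvar ^ (sum_list p - 2)) + (\<Sum>p\<in>?D. qvar ^ (sum_list p - 2)) = 2 * (\<Sum>p\<in>?S. qvar ^ (sum_list p - 2))"
      unfolding sum_rect_fold by (simp add: sum_distrib_left)
    finally show "(C + r) / 2 * qint (n + n - 2 + 2) = (\<Sum>p\<in>?S. qvar ^ (sum_list p - 2))"
      unfolding n2 by simp
  next
    fix I assume I: "I \<in> order_ideals ?S list_le"
    let ?J = "unfold_ideal I"
    note J = unfold_ideal[OF I]
    have D: "p \<in> ?S" "rev p = p" if "p \<in> ?D" for p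
      using that diag_subset_stair by (auto simp: diag_set_def)
    have fold: "(\<Sum>p\<in>?R. h p * T p) = (\<Sum>p\<in>?S. (h p + h (rev p)) * T' p) - (\<Sum>p\<in>?D. h p * T' p)"
      if "\<And>p. p \<in> ?S \<Longrightarrow> T p = T' p" "\<And>p. p \<in> ?S \<Longrightarrow> T (rev p) = T' p" for h T T' :: "nat list \<Rightarrow> ratfun"
    proof -
      have "(\<Sum>p\<in>?R. h p * T p) = (\<Sum>p\<in>?S. h p * T p + h (rev p) * T (rev p)) - (\<Sum>p\<in>?D. h p * T p)"
        using sum_rect_fold[of "\<lambda>p. h p * T p" n] by (simp add: algebra_simps)
      also have "(\<Sum>p\<in>?D. h p * T p) = (\<Sum>p\<in>?D. h p * T' p)"
        using that D by (intro sum.cong) auto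
      also have "(\<Sum>p\<in>?S. h p * T p + h (rev p) * T (rev p)) = (\<Sum>p\<in>?S. (h p + h (rev p)) * T' p)"
        using that by (intro sum.cong) (auto simp: algebra_simps)
      finally show ?thesis .
    qed
    let ?Tm = "\<lambda>p. Tminus ?S list_le p I" and ?Tq = "\<lambda>p. Tq ?S list_le p I"
    have "(\<Sum>p\<in>?S. 2 * ?Tm p) - (\<Sum>p\<in>?D. ?Tm p) - C = (\<Sum>p\<in>?S. (c p + c (rev p)) * ?Tq p) - (\<Sum>p\<in>?D. c p * ?Tq p)"
      using c[OF J(1)] fold[of "\<lambda>p. Tminus ?R list_le p ?J" ?Tm "\<lambda>_. 1"]
        fold[of "\<lambda>p. Tq ?R list_le p ?J" ?Tq c] J by (simp add: Tq_def)
    moreover have "(\<Sum>p\<in>?D. ?Tm p) = r - (\<Sum>p\<in>?D. r * ?Tq p)"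
    proof -
      have "r = r * (\<Sum>p\<in>?D. Tplus ?S list_le p I + ?Tm p)"
        using diag_toggle_sum[OF I assms] by simp
      also have "\<dots> = (\<Sum>p\<in>?D. r * ?Tq p + (r * (1 + qvar)) * ?Tm p)"
        unfolding sum_distrib_left by (intro sum.cong refl) (simp add: Tq_def algebra_simps)
      finally show ?thesis
        unfolding r by (simp add: sum.distrib algebra_simps)
    qed
    moreover have "(\<Sum>p\<in>?S. if p \<in> ?D then (c p + r) * ?Tq p else 0) = (\<Sum>p\<in>?D. (c p + r) * ?Tq p)"
      using diag_subset_stair[of n] finite_stair[of n]
      by (simp add: sum.inter_restrict[symmetric] Int_absorb1)
    ultimately have "2 * ((\<Sum>p\<in>?S. ?Tm p) - (C + r) / 2) =
        (\<Sum>p\<in>?S. (c p + c (rev p)) * ?Tq p - (if p \<in> ?D then (c p + r) * ?Tq p else 0))"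
      by (simp add: sum_subtractf sum.distrib sum_distrib_left algebra_simps)
    also have "\<dots> = 2 * (\<Sum>p\<in>?S. d p * ?Tq p)"
      unfolding sum_distrib_left by (intro sum.cong refl) (simp add: d_def algebra_simps)
    finally show "(\<Sum>p\<in>?S. ?Tm p) - (C + r) / 2 = (\<Sum>p\<in>?S. d p * ?Tq p)"
      by (rule mult_left_cancel[THEN iffD1, rotated]) simp
  qed (use rk_stair Max_rk_stair assms in auto)
qed

subsection \<open>Double-tailed diamonds\<close>

lemma diamond_le_pair [simp]:
  "diamond_le [t, i] [s, j] \<longleftrightarrow>
     (t = 0 \<and> s = 0 \<and> i \<le> j) \<or> (t = 1 \<and> s = 1 \<and> i = j) \<or> (t = 2 \<and> s = 2 \<and> j \<le> i) \<or> t < s"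
  by (simp add: diamond_le_def)

lemma diamond_mem [simp]:
  "[t, i] \<in> diamond_set (Suc m) \<longleftrightarrow>
     (t = 0 \<or> t = 2) \<and> 1 \<le> i \<and> i \<le> m \<or> t = 1 \<and> (i = 1 \<or> i = 2)"
  by (auto simp: diamond_set_def)

lemma diamondE:
  assumes "p \<in> diamond_set (Suc m)"
  obtains (x) i where "p = [0, i]" "1 \<le> i" "i \<le> m"
    | (y) i where "p = [1, i]" "i = 1 \<or> i = 2"
    | (z) i where "p = [2, i]" "1 \<le> i" "i \<le> m"
  using assms by (auto simp: diamond_set_def)

lemma sum_diamond:
  "(\<Sum>p\<in>diamond_set (Suc m). h p) =
     (\<Sum>k<m. h [0, Suc k]) + (h [1, 1] + h [1, 2]) + (\<Sum>k<m. h [2, Suc k])"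
proof -
  have chain: "(\<Sum>p\<in>{[t, i] | i. 1 \<le> i \<and> i \<le> m}. h p) = (\<Sum>k<m. h [t, Suc k])"
    and finite: "finite {[t, i] | i. 1 \<le> i \<and> i \<le> m}" for t :: nat
  proof -
    have "[t, i] \<in> (\<lambda>k. [t, Suc k]) ` {..<m}" if "1 \<le> i" "i \<le> m" for i
      using that by (intro image_eqI[of _ _ "i - 1"]) auto
    then have eq: "{[t, i] | i. 1 \<le> i \<and> i \<le> m} = (\<lambda>k. [t, Suc k]) ` {..<m}"
      by auto
    show "(\<Sum>p\<in>{[t, i] | i. 1 \<le> i \<and> i \<le> m}. h p) = (\<Sum>k<m. h [t, Suc k])"
      unfolding eq by (simp add: sum.reindex inj_on_def)
    show "finite {[t, i] | i. 1 \<le> i \<and> i \<le> m}"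
      unfolding eq by simp
  qed
  let ?X = "{[0, i] | i. 1 \<le> i \<and> i \<le> m}" and ?Z = "{[2, i] | i. 1 \<le> i \<and> i \<le> m}"
  have "diamond_set (Suc m) = (?X \<union> {[1, 1], [1, 2]}) \<union> ?Z"
    by (simp add: diamond_set_def)
  moreover have "sum h ((?X \<union> {[1, 1], [1, 2]}) \<union> ?Z) = sum h (?X \<union> {[1, 1], [1, 2]}) + sum h ?Z"
    by (rule sum.union_disjoint) (use finite[of 0] finite[of 2] in auto)
  moreover have "sum h (?X \<union> {[1, 1], [1, 2]}) = sum h ?X + sum h {[1, 1], [1, 2]}"
    by (rule sum.union_disjoint) (use finite[of 0] in auto)
  ultimately show ?thesis
    by (simp add: chain[simplified])
qed

lemma strict_diamond_le_trans:
  assumes "x \<in> diamond_set (Suc m)" "y \<in> diamond_set (Suc m)" "z \<in> diamond_set (Suc m)"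
    and "strict_lt diamond_le x y" "strict_lt diamond_le y z"
  shows "strict_lt diamond_le x z"
proof -
  obtain t i s j u k where "x = [t, i]" "y = [s, j]" "z = [u, k]"
    using assms(1-3) by (meson diamondE)
  with assms(4,5) show ?thesis
    by (auto simp: strict_lt_def)
qed

definition diamond_rk :: "nat \<Rightarrow> nat list \<Rightarrow> nat" where
  "diamond_rk m p = (if p ! 0 = 0 then p ! 1 - 1 else if p ! 0 = 1 then m else Suc (2 * m) - p ! 1)"

lemma rk_diamond:
  assumes "1 \<le> m" "p \<in> diamond_set (Suc m)"
  shows "rk (diamond_set (Suc m)) diamond_le p = diamond_rk m p"
proof (rule rk_eqI)
  fix x y assume "x \<in> diamond_set (Suc m)" "y \<in> diamond_set (Suc m)" "strict_lt diamond_le x y"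
  from this show "diamond_rk m x < diamond_rk m y"
    by (cases rule: diamondE[case_product diamondE]) (auto simp: diamond_rk_def strict_lt_def)
next
  fix p assume p: "p \<in> diamond_set (Suc m)" "diamond_rk m p \<noteq> 0"
  from p(1) show "\<exists>y\<in>diamond_set (Suc m). strict_lt diamond_le y p \<and> Suc (diamond_rk m y) = diamond_rk m p"
  proof (cases rule: diamondE)
    case (x i)
    with p(2) show ?thesis
      by (intro bexI[of _ "[0, i - 1]"]) (auto simp: diamond_rk_def strict_lt_def)
  next
    case (y i)
    with \<open>1 \<le> m\<close> show ?thesis
      by (intro bexI[of _ "[0, m]"]) (auto simp: diamond_rk_def strict_lt_def)
  next
    case (z i)
    show ?thesis
    proof (cases "i = m")
      case True
      with z show ?thesis
        by (intro bexI[of _ "[1, 1]"]) (auto simp: diamond_rk_def strict_lt_def)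
    next
      case False
      with z show ?thesis
        by (intro bexI[of _ "[2, Suc i]"]) (auto simp: diamond_rk_def strict_lt_def)
    qed
  qed
qed (use assms strict_diamond_le_trans in blast)+

lemma Max_diamond_rk:
  assumes "1 \<le> m"
  shows "Max (diamond_rk m ` diamond_set (Suc m)) = 2 * m"
proof (rule Max_eqI)
  have bound: "diamond_rk m p \<le> 2 * m" if "p \<in> diamond_set (Suc m)" for p
    using that by (cases rule: diamondE) (auto simp: diamond_rk_def)
  then show "finite (diamond_rk m ` diamond_set (Suc m))"
    unfolding finite_nat_set_iff_bounded_le by (intro exI[of _ "2 * m"]) blast
  show "2 * m \<in> diamond_rk m ` diamond_set (Suc m)"
    using assms by (intro image_eqI[of _ _ "[2, 1]"]) (auto simp: diamond_rk_def)
  show "y \<le> 2 * m" if "y \<in> diamond_rk m ` diamond_set (Suc m)" for y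
    using that bound by blast
qed

text \<open>Numerators over the common denominator 1 + q^(m+1), where m = n - 1. The empty ideal
  forces -(1 + q^m) at \<open>[0, 1]\<close>. Successive ideals along either chain force each
  coefficient to be q times the one below it plus q^(m+1) - q^m; ideals around the middle level,
  with symmetry of the two middle elements, give the rest.\<close>

definition diamond_coeff :: "nat \<Rightarrow> nat list \<Rightarrow> ratfun" where
  "diamond_coeff m p = (if p ! 0 = 0 then - (qvar ^ m + qvar ^ (p ! 1 - 1))
     else if p ! 0 = 1 then - (qvar ^ m) else qvar ^ (m - p ! 1) - qvar ^ m)"

text \<open>The constant is the value of the corner sum at the empty ideal. The sums over the two
  chains telescope with potentials \<^term>\<open>U\<close> and \<^term>\<open>V\<close>.\<close>
lemma diamond_corner_sum:
  assumes "1 \<le> m" and I: "I \<in> order_ideals (diamond_set (Suc m)) diamond_le"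
  defines "P \<equiv> diamond_set (Suc m)"
  shows "(\<Sum>p\<in>P. (1 + qvar ^ Suc m) * Tminus P diamond_le p I - diamond_coeff m p * Tq P diamond_le p I)
    = 1 + qvar ^ m"
proof -
  define x :: "nat \<Rightarrow> ratfun" where "x k = of_bool (k = 0 \<or> [0, k] \<in> I)" for k
  define y :: "nat \<Rightarrow> ratfun" where "y k = of_bool ([1, k] \<in> I)" for k
  define z :: "nat \<Rightarrow> ratfun" where "z k = of_bool ([2, k] \<in> I)" for k
  have I': "I \<in> order_ideals P diamond_le" and sub: "I \<subseteq> P"
    using I by (auto simp: order_ideals_def P_def)
  have mem: "[t, i] \<in> I \<Longrightarrow> (t = 0 \<or> t = 2) \<and> 1 \<le> i \<and> i \<le> m \<or> t = 1 \<and> (i = 1 \<or> i = 2)" for t i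
    using sub by (force simp: P_def)
  have down: "[s, j] \<in> I" if "[t, i] \<in> I" "[s, j] \<in> P" "diamond_le [s, j] [t, i]" for s t i j
    using order_ideals_downD[OF I' that(1)] that by blast
  have elim: "\<exists>t i. p = [t, i] \<and> ((t = 0 \<or> t = 2) \<and> 1 \<le> i \<and> i \<le> m \<or> t = 1 \<and> (i = 1 \<or> i = 2))" if "p \<in> P" for p
    using that unfolding P_def by (cases rule: diamondE) auto
  \<comment> \<open>Both chains are continued through the middle level: past its top the lower chain
    sees whether I contains at least one middle element, and below its bottom the upper chain sees
    whether I contains both. The value \<open>x 0 = 1\<close> plays the part of an element below
    everything.\<close>
  define x' where "x' k = (if k \<le> m then x k else y 1 + y 2 - y 1 * y 2)" for k
  define z' where "z' k = (if k \<le> m then z k else y 1 * y 2)" for k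
  have xp: "Tplus P diamond_le [0, Suc k] I = x' k - x' (Suc k)" if "k < m" for k
  proof -
    have "Tplus P diamond_le [0, Suc k] I = of_bool ([0, Suc k] \<notin> I \<and> {[0, k]} \<inter> P \<subseteq> I)"
    proof (rule Tplus_eqI[OF I'])
      fix p assume "p \<in> P" "strict_lt diamond_le p [0, Suc k]"
      then show "\<exists>u\<in>{[0, k]} \<inter> P. diamond_le p u"
        using elim[of p] that by (auto simp: strict_lt_def P_def)
    qed (use that in \<open>auto simp: strict_lt_def P_def\<close>)
    then show ?thesis
      using that down[of 0 "Suc k" 0 k] by (cases k) (auto simp: x'_def x_def P_def)
  qed
  have xm: "Tminus P diamond_le [0, Suc k] I = x' (Suc k) - x' (Suc (Suc k))" if "k < m" for k
  proof (cases "Suc k = m")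
    case True
    have "Tminus P diamond_le [0, Suc k] I = of_bool ([0, Suc k] \<in> I \<and> {[1, 1], [1, 2]} \<inter> I = {})"
    proof (rule Tminus_eqI[OF I'])
      fix p assume "p \<in> P" "strict_lt diamond_le [0, Suc k] p"
      then show "\<exists>u\<in>{[1, 1], [1, 2]}. diamond_le u p"
        using elim[of p] True by (auto simp: strict_lt_def P_def)
    qed (use that in \<open>auto simp: strict_lt_def P_def\<close>)
    then show ?thesis
      using True down[of 1 1 0 m] down[of 1 2 0 m] by (auto simp: x'_def x_def y_def P_def)
  next
    case False
    have "Tminus P diamond_le [0, Suc k] I = of_bool ([0, Suc k] \<in> I \<and> {[0, Suc (Suc k)]} \<inter> I = {})"
    proof (rule Tminus_eqI[OF I'])
      fix p assume "p \<in> P" "strict_lt diamond_le [0, Suc k] p"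
      then show "\<exists>u\<in>{[0, Suc (Suc k)]}. diamond_le u p"
        using elim[of p] False that by (auto simp: strict_lt_def P_def)
    qed (use that False in \<open>auto simp: strict_lt_def P_def\<close>)
    then show ?thesis
      using False that down[of 0 "Suc (Suc k)" 0 "Suc k"] by (auto simp: x'_def x_def P_def)
  qed
  have yp: "Tplus P diamond_le [1, i] I = x m - y i" if "i = 1 \<or> i = 2" for i
  proof -
    have "Tplus P diamond_le [1, i] I = of_bool ([1, i] \<notin> I \<and> {[0, m]} \<subseteq> I)"
    proof (rule Tplus_eqI[OF I'])
      fix p assume "p \<in> P" "strict_lt diamond_le p [1, i]"
      then show "\<exists>u\<in>{[0, m]}. diamond_le p u"
        using elim[of p] by (auto simp: strict_lt_def P_def)
    qed (use that \<open>1 \<le> m\<close> in \<open>auto simp: strict_lt_def P_def\<close>)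
    then show ?thesis
      using \<open>1 \<le> m\<close> down[of 1 i 0 m] by (auto simp: x_def y_def P_def)
  qed
  have ym: "Tminus P diamond_le [1, i] I = y i - z m" if "i = 1 \<or> i = 2" for i
  proof -
    have "Tminus P diamond_le [1, i] I = of_bool ([1, i] \<in> I \<and> {[2, m]} \<inter> I = {})"
    proof (rule Tminus_eqI[OF I'])
      fix p assume "p \<in> P" "strict_lt diamond_le [1, i] p"
      then show "\<exists>u\<in>{[2, m]}. diamond_le u p"
        using elim[of p] by (auto simp: strict_lt_def P_def)
    qed (use that \<open>1 \<le> m\<close> in \<open>auto simp: strict_lt_def P_def\<close>)
    then show ?thesis
      using that down[of 2 m 1 i] by (auto simp: z_def y_def P_def)
  qed
  have zp: "Tplus P diamond_le [2, Suc k] I = z' (Suc (Suc k)) - z' (Suc k)" if "k < m" for k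
  proof (cases "Suc k = m")
    case True
    have "Tplus P diamond_le [2, Suc k] I = of_bool ([2, Suc k] \<notin> I \<and> {[1, 1], [1, 2]} \<subseteq> I)"
    proof (rule Tplus_eqI[OF I'])
      fix p assume "p \<in> P" "strict_lt diamond_le p [2, Suc k]"
      then show "\<exists>u\<in>{[1, 1], [1, 2]}. diamond_le p u"
        using elim[of p] True by (auto simp: strict_lt_def P_def)
    qed (use that in \<open>auto simp: strict_lt_def P_def\<close>)
    then show ?thesis
      using True down[of 2 m 1 1] down[of 2 m 1 2] by (auto simp: z'_def z_def y_def P_def)
  next
    case False
    have "Tplus P diamond_le [2, Suc k] I = of_bool ([2, Suc k] \<notin> I \<and> {[2, Suc (Suc k)]} \<subseteq> I)"
    proof (rule Tplus_eqI[OF I'])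
      fix p assume "p \<in> P" "strict_lt diamond_le p [2, Suc k]"
      then show "\<exists>u\<in>{[2, Suc (Suc k)]}. diamond_le p u"
        using elim[of p] False that by (auto simp: strict_lt_def P_def)
    qed (use that False in \<open>auto simp: strict_lt_def P_def\<close>)
    then show ?thesis
      using False that down[of 2 "Suc k" 2 "Suc (Suc k)"] by (auto simp: z'_def z_def P_def)
  qed
  have zm: "Tminus P diamond_le [2, Suc k] I = z' (Suc k) - z' k" if "k < m" for k
  proof -
    have "Tminus P diamond_le [2, Suc k] I = of_bool ([2, Suc k] \<in> I \<and> ({[2, k]} \<inter> P) \<inter> I = {})"
    proof (rule Tminus_eqI[OF I'])
      fix p assume "p \<in> P" "strict_lt diamond_le [2, Suc k] p"
      then show "\<exists>u\<in>{[2, k]} \<inter> P. diamond_le u p"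
        using elim[of p] that by (auto simp: strict_lt_def P_def)
    qed (use that in \<open>auto simp: strict_lt_def P_def\<close>)
    then show ?thesis
      using that sub down[of 2 k 2 "Suc k"] mem[of 2 k] by (auto simp: z'_def z_def P_def)
  qed
  define U where "U k = (qvar ^ m + qvar ^ k) * x' k + (1 - qvar ^ k) * x' (Suc k)" for k
  define V where "V k = (qvar ^ m - qvar ^ (m - k)) * z' (Suc k) + (1 + qvar ^ (m - k)) * z' k" for k
  let ?f = "\<lambda>p. (1 + qvar ^ Suc m) * Tminus P diamond_le p I - diamond_coeff m p * Tq P diamond_le p I"
  have "(\<Sum>k<m. ?f [0, Suc k]) = (\<Sum>k<m. U k - U (Suc k))"
    by (intro sum.cong refl) (simp add: Tq_def xm xp U_def diamond_coeff_def algebra_simps)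
  moreover have "(\<Sum>k<m. ?f [2, Suc k]) = (\<Sum>k<m. V (Suc k) - V k)"
  proof (intro sum.cong refl)
    fix k assume "k \<in> {..<m}"
    then have "m - k = Suc (m - Suc k)" "k < m"
      by auto
    then show "?f [2, Suc k] = V (Suc k) - V k"
      by (simp add: Tq_def zm zp V_def diamond_coeff_def algebra_simps)
  qed
  moreover have "?f [1, i] = (1 - qvar ^ m) * y i - z m + qvar ^ m * x m" if "i = 1 \<or> i = 2" for i
    using that by (simp add: Tq_def ym yp diamond_coeff_def algebra_simps del: One_nat_def)
  from this[OF disjI1, OF refl] this[OF disjI2, OF refl]
  have "?f [1, 1] + ?f [1, 2] = (1 - qvar ^ m) * (y 1 + y 2) - 2 * z m + 2 * (qvar ^ m * x m)"
    by (simp only:) (simp add: algebra_simps)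
  ultimately have "(\<Sum>p\<in>P. ?f p) = U 0 - U m + ((1 - qvar ^ m) * (y 1 + y 2) - 2 * z m + 2 * (qvar ^ m * x m)) + (V m - V 0)"
    by (simp only: P_def sum_diamond sum_lessThan_telescope sum_lessThan_telescope')
  moreover have "z 0 = 0"
    using mem[of 2 0] by (auto simp: z_def)
  \<comment> \<open>The product \<open>y 1 * y 2\<close> enters through \<open>U m\<close> and
    \<open>V m\<close> and cancels, as do the terms in \<open>x m\<close> and \<open>z m\<close>.
    What remains is \<open>U 0\<close>.\<close>
  ultimately show ?thesis
    by (simp add: U_def V_def x'_def z'_def x_def[of 0] algebra_simps)
qed

lemma antichain_const_diamond:
  assumes "2 \<le> n"
  shows "antichain_const (diamond_set n) diamond_le"
proof -
  obtain m where n: "n = Suc m" and "1 \<le> m"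
    using assms by (cases n) auto
  let ?D = "1 + qvar ^ Suc m"
  have D: "?D \<noteq> 0"
    using one_plus_qvar_power_neq_0[of "Suc m"] by simp
  show ?thesis
    unfolding n
  proof (rule antichain_constI)
    have "qvar ^ (Suc (2 * m) - Suc k) = qvar ^ Suc m * qvar ^ (m - Suc k)" if "k < m" for k
    proof -
      have "Suc (2 * m) - Suc k = Suc m + (m - Suc k)"
        using that by simp
      then show ?thesis
        by (simp only: power_add)
    qed
    then have "(\<Sum>k<m. qvar ^ (Suc (2 * m) - Suc k)) = qvar ^ Suc m * (\<Sum>k<m. qvar ^ (m - Suc k))"
      unfolding sum_distrib_left by (intro sum.cong) auto
    also have "(\<Sum>k<m. qvar ^ (m - Suc k)) = qint m"
      unfolding qint_def by (rule sum.nat_diff_reindex)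
    finally have "(\<Sum>p\<in>diamond_set (Suc m). qvar ^ diamond_rk m p) = qint m + 2 * qvar ^ m + qvar ^ Suc m * qint m"
      by (simp add: sum_diamond diamond_rk_def qint_def)
    also have "\<dots> = (1 + qvar ^ m) * qint (Suc m)"
    proof -
      have "qint m + 2 * qvar ^ m + qvar ^ Suc m * qint m = (qint m + qvar ^ m) + qvar ^ m * (1 + qvar * qint m)"
        by (simp add: algebra_simps)
      also have "\<dots> = (1 + qvar ^ m) * qint (Suc m)"
        unfolding qint_Suc[symmetric] qint_Suc_shift[symmetric] by (simp add: algebra_simps)
      finally show ?thesis .
    qed
    \<comment> \<open>This is the factorisation [2m+2] = (1 + q^(m+1)) [m+1], checked after
      multiplying by 1 - q.\<close>
    also have "\<dots> = (1 + qvar ^ m) / ?D * qint (2 * m + 2)"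
    proof -
      have "(1 - qvar) * (?D * qint (Suc m)) = ?D * (1 - qvar ^ Suc m)"
        by (metis mult.left_commute qint_mult)
      also have "\<dots> = (1 - qvar) * qint (Suc m + Suc m)"
        unfolding qint_mult power_add by (simp only: algebra_simps)
      finally have "(1 - qvar) * qint (Suc m + Suc m) = (1 - qvar) * (?D * qint (Suc m))" ..
      moreover have "1 - qvar \<noteq> 0"
        using qvar_power_neq_1[of 1] by simp
      ultimately have "qint (2 * m + 2) = ?D * qint (Suc m)"
        by (simp add: mult_2)
      with D show ?thesis
        by simp
    qed
    finally show "(1 + qvar ^ m) / ?D * qint (2 * m + 2) = (\<Sum>p\<in>diamond_set (Suc m). qvar ^ diamond_rk m p)" ..
  next
    fix I assume I: "I \<in> order_ideals (diamond_set (Suc m)) diamond_le"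
    let ?P = "diamond_set (Suc m)"
    have "?D * (\<Sum>p\<in>?P. Tminus ?P diamond_le p I) - (\<Sum>p\<in>?P. diamond_coeff m p * Tq ?P diamond_le p I) = 1 + qvar ^ m"
      using diamond_corner_sum[OF \<open>1 \<le> m\<close> I] by (simp only: sum_subtractf sum_distrib_left)
    then have "?D * ((\<Sum>p\<in>?P. Tminus ?P diamond_le p I) - (1 + qvar ^ m) / ?D) = (\<Sum>p\<in>?P. diamond_coeff m p * Tq ?P diamond_le p I)"
      using D by (simp add: right_diff_distrib del: power_Suc)
    then have "(\<Sum>p\<in>?P. Tminus ?P diamond_le p I) - (1 + qvar ^ m) / ?D = (\<Sum>p\<in>?P. diamond_coeff m p * Tq ?P diamond_le p I) / ?D"
      using D by (simp add: eq_divide_eq mult.commute del: power_Suc)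
    then show "(\<Sum>p\<in>?P. Tminus ?P diamond_le p I) - (1 + qvar ^ m) / ?D = (\<Sum>p\<in>?P. diamond_coeff m p / ?D * Tq ?P diamond_le p I)"
      by (simp add: sum_divide_distrib)
  qed (use rk_diamond Max_diamond_rk \<open>1 \<le> m\<close> in auto)
qed

subsection \<open>The exceptional posets\<close>

text \<open>The head is decided last, against the elements after it. If larger elements come first,
  as in both tables below, only ideals are produced; for any order of the list no ideal is missed,
  and the proof relies on that.\<close>

primrec subideals :: "('a \<Rightarrow> 'a \<Rightarrow> bool) \<Rightarrow> 'a list \<Rightarrow> 'a list list" where
  "subideals le [] = [[]]"
| "subideals le (p # ps) =
     concat (map (\<lambda>L. if \<forall>y\<in>set ps. le y p \<longrightarrow> y \<in> set L then [L, p # L] else [L]) (subideals le ps))"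

lemma subideals_complete:
  assumes "I \<in> order_ideals P le" "set ps \<subseteq> P"
  shows "\<exists>L\<in>set (subideals le ps). set L = I \<inter> set ps"
  using assms(2)
proof (induction ps)
  case (Cons p ps)
  then obtain L where L: "L \<in> set (subideals le ps)" "set L = I \<inter> set ps"
    by auto
  show ?case
  proof (cases "p \<in> I")
    case True
    then have "\<forall>y\<in>set ps. le y p \<longrightarrow> y \<in> set L"
      using L(2) Cons.prems order_ideals_downD[OF assms(1) True] by auto
    then have "p # L \<in> set (subideals le (p # ps))"
      using L(1) by auto
    with True L(2) show ?thesis
      by (intro bexI[of _ "p # L"]) auto
  next
    case False
    with L show ?thesis
      by (intro bexI[of _ L]) auto
  qed
qed simp

text \<open>Polynomials in \<^term>\<open>qvar\<close> are represented by their coefficient lists, constant term first.\<close>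
primrec peval :: "int list \<Rightarrow> ratfun" where
  "peval [] = 0"
| "peval (a # as) = of_int a + qvar * peval as"

fun padd :: "int list \<Rightarrow> int list \<Rightarrow> int list" where
  "padd [] bs = bs"
| "padd as [] = as"
| "padd (a # as) (b # bs) = (a + b) # padd as bs"

primrec pmul :: "int list \<Rightarrow> int list \<Rightarrow> int list" where
  "pmul [] bs = []"
| "pmul (a # as) bs = padd (map ((*) a) bs) (0 # pmul as bs)"

text \<open>Testing the difference for zero makes trailing zeros harmless, as a polynomial has many
  coefficient lists.\<close>

definition peq :: "int list \<Rightarrow> int list \<Rightarrow> bool" where
  "peq as bs \<longleftrightarrow> (\<forall>c\<in>set (padd as (map uminus bs)). c = 0)"

lemma peval_padd [simp]: "peval (padd as bs) = peval as + peval bs"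
  by (induction as bs rule: padd.induct) (simp_all add: algebra_simps)

lemma peval_map_times [simp]: "peval (map ((*) a) bs) = of_int a * peval bs"
  by (induction bs) (simp_all add: algebra_simps)

lemma peval_map_uminus [simp]: "peval (map uminus bs) = - peval bs"
  by (induction bs) (simp_all add: algebra_simps)

lemma peval_pmul [simp]: "peval (pmul as bs) = peval as * peval bs"
  by (induction as) (simp_all add: algebra_simps)

lemma peval_peq: "peq as bs \<Longrightarrow> peval as = peval bs"
proof -
  have "\<forall>c\<in>set cs. c = 0 \<Longrightarrow> peval cs = 0" for cs
    by (induction cs) auto
  from this[of "padd as (map uminus bs)"] show "peq as bs \<Longrightarrow> peval as = peval bs"
    by (simp add: peq_def)
qed

lemma peval_ones: "peval (replicate m 1) = qint m"
  by (induction m) (simp_all add: qint_Suc_shift)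

lemma peval_monom: "peval (replicate m 0 @ [1]) = qvar ^ m"
  by (induction m) simp_all

text \<open>Each row lists an element \<^term>\<open>p\<close>, its lower and upper covers, and the numerator of the
  coefficient of \<^term>\<open>Tq P list_le p\<close>. The common denominator \<^term>\<open>D\<close> divides
  \<^term>\<open>qint (m + 2)\<close> with cofactor \<^term>\<open>K\<close>, and the constant is \<^term>\<open>C\<close> over \<^term>\<open>D\<close>.\<close>
type_synonym certificate = "(nat list \<times> nat list list \<times> nat list list \<times> int list) list"

definition valid_covers :: "nat list list \<Rightarrow> nat list \<Rightarrow> nat list list \<Rightarrow> nat list list \<Rightarrow> bool" where
  "valid_covers ps p ls us \<longleftrightarrow>
     (\<forall>u\<in>set ls. u \<in> set ps \<and> strict_lt list_le u p) \<and>
     (\<forall>y\<in>set ps. strict_lt list_le y p \<longrightarrow> (\<exists>u\<in>set ls. list_le y u)) \<and>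
     (\<forall>u\<in>set us. u \<in> set ps \<and> strict_lt list_le p u) \<and>
     (\<forall>y\<in>set ps. strict_lt list_le p y \<longrightarrow> (\<exists>u\<in>set us. list_le u y))"

text \<open>The coefficient list of \<open>D * Tminus - N * Tq\<close> at one element: D + q N if it
  can be removed, -N if it can be added, and 0 otherwise.\<close>

definition row_sum ::
  "int list \<Rightarrow> nat list list \<Rightarrow> nat list \<times> nat list list \<times> nat list list \<times> int list \<Rightarrow> int list" where
  "row_sum D L = (\<lambda>(p, ls, us, N).
     if p \<in> set L then if \<exists>u\<in>set us. u \<in> set L then [] else padd D (0 # N)
     else if \<forall>u\<in>set ls. u \<in> set L then map uminus N else [])"

text \<open>The clauses on \<open>sum_list\<close> make the rank of a root its height minus 1 and
  the largest rank m. The last clause is the required identity times D, one instance for each listed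
  ideal.\<close>

definition valid_certificate ::
  "nat \<Rightarrow> int list \<Rightarrow> int list \<Rightarrow> int list \<Rightarrow> certificate \<Rightarrow> bool" where
  "valid_certificate m D K C T \<longleftrightarrow> (let ps = map fst T in
     distinct ps \<and>
     (\<forall>(p, ls, us, N)\<in>set T. valid_covers ps p ls us \<and> 1 \<le> sum_list p \<and> sum_list p \<le> Suc m \<and>
        (sum_list p \<noteq> 1 \<longrightarrow> (\<exists>u\<in>set ls. Suc (sum_list u) = sum_list p))) \<and>
     (\<exists>p\<in>set ps. sum_list p = Suc m) \<and>
     peq (pmul D K) (replicate (m + 2) 1) \<and>
     peq (pmul C K) (foldr (\<lambda>p. padd (replicate (sum_list p - 1) 0 @ [1])) ps []) \<and>
     (\<forall>L\<in>set (subideals list_le ps). peq (foldr (\<lambda>r. padd (row_sum D L r)) T []) C))"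

lemma peval_foldr: "peval (foldr (\<lambda>x. padd (f x)) xs []) = (\<Sum>x\<leftarrow>xs. peval (f x))"
  by (induction xs) simp_all

lemma antichain_const_certificate:
  assumes "valid_certificate m D K C T"
  shows "antichain_const (set (map fst T)) list_le"
proof -
  define ps where "ps = map fst T"
  define P where "P = set ps"
  have dist: "distinct ps"
    and row: "\<And>p ls us N. (p, ls, us, N) \<in> set T \<Longrightarrow> valid_covers ps p ls us \<and> 1 \<le> sum_list p \<and>
        sum_list p \<le> Suc m \<and> (sum_list p \<noteq> 1 \<longrightarrow> (\<exists>u\<in>set ls. Suc (sum_list u) = sum_list p))"
    and top: "\<exists>p\<in>P. sum_list p = Suc m"
    and DK: "peval D * peval K = qint (m + 2)"
    and CK: "peval C * peval K = (\<Sum>p\<leftarrow>ps. qvar ^ (sum_list p - 1))"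
    and total: "\<And>L. L \<in> set (subideals list_le ps) \<Longrightarrow> (\<Sum>r\<leftarrow>T. peval (row_sum D L r)) = peval C"
  proof -
    note valid = assms[unfolded valid_certificate_def Let_def, folded ps_def]
    show "distinct ps" "\<exists>p\<in>P. sum_list p = Suc m"
      using valid by (auto simp: P_def)
    show "valid_covers ps p ls us \<and> 1 \<le> sum_list p \<and>
        sum_list p \<le> Suc m \<and> (sum_list p \<noteq> 1 \<longrightarrow> (\<exists>u\<in>set ls. Suc (sum_list u) = sum_list p))"
      if "(p, ls, us, N) \<in> set T" for p ls us N
      using valid that by blast
    have "peq (pmul D K) (replicate (m + 2) 1)"
      and "peq (pmul C K) (foldr (\<lambda>p. padd (replicate (sum_list p - 1) 0 @ [1])) ps [])"
      using valid by blast+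
    from this[THEN peval_peq] show "peval D * peval K = qint (m + 2)"
      and "peval C * peval K = (\<Sum>p\<leftarrow>ps. qvar ^ (sum_list p - 1))"
      by (simp_all only: peval_pmul peval_ones peval_foldr peval_monom)
    show "(\<Sum>r\<leftarrow>T. peval (row_sum D L r)) = peval C" if "L \<in> set (subideals list_le ps)" for L
    proof -
      have "peq (foldr (\<lambda>r. padd (row_sum D L r)) T []) C"
        using valid that by blast
      from peval_peq[OF this] show ?thesis
        by (simp only: peval_foldr)
    qed
  qed
  have D0: "peval D \<noteq> 0"
    using DK qint_neq_0[of "m + 2"] by auto
  define N where "N p = peval (snd (snd (the (map_of T p))))" for p
  have N: "N p = peval n" if "(p, ls, us, n) \<in> set T" for p ls us n
    using dist that by (simp add: N_def ps_def)
  have sum_P: "(\<Sum>p\<in>P. h p) = (\<Sum>p\<leftarrow>ps. h p)" for h :: "nat list \<Rightarrow> ratfun"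
    using dist by (simp add: P_def sum_list_distinct_conv_sum_set)
  have P_row: "\<exists>ls us n. (p, ls, us, n) \<in> set T" if "p \<in> P" for p
    using that by (force simp: P_def ps_def)
  have "antichain_const P list_le"
  proof (rule antichain_constI)
    show "rk P list_le p = sum_list p - 1" if "p \<in> P" for p
    proof (rule rk_list_le[OF _ _ that])
      fix p assume "p \<in> P"
      then obtain ls us n where r: "(p, ls, us, n) \<in> set T"
        using P_row by blast
      show "1 \<le> sum_list p"
        using row[OF r] by blast
      assume "sum_list p \<noteq> 1"
      then show "\<exists>y\<in>P. list_le y p \<and> Suc (sum_list y) = sum_list p"
        using row[OF r] unfolding valid_covers_def P_def strict_lt_def by blast
    qed
    show "Max ((\<lambda>p. sum_list p - 1) ` P) = m"
    proof (rule Max_eqI)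
      show "finite ((\<lambda>p. sum_list p - 1) ` P)"
        by (simp add: P_def)
      show "m \<in> (\<lambda>p. sum_list p - 1) ` P"
        using top by force
      show "y \<le> m" if "y \<in> (\<lambda>p. sum_list p - 1) ` P" for y
        using that P_row row by fastforce
    qed
    show "peval C / peval D * qint (m + 2) = (\<Sum>p\<in>P. qvar ^ (sum_list p - 1))"
      unfolding sum_P CK[symmetric] DK[symmetric] using D0 by simp
  next
    fix I assume I: "I \<in> order_ideals P list_le"
    obtain L where L: "L \<in> set (subideals list_le ps)" "set L = I"
      using subideals_complete[OF I, of ps] I by (auto simp: P_def order_ideals_def Int_absorb2)
    have "peval (row_sum D L r) =
        peval D * Tminus P list_le (fst r) I - N (fst r) * Tq P list_le (fst r) I" if "r \<in> set T" for r
    proof -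
      obtain p ls us n where r: "r = (p, ls, us, n)"
        by (cases r) auto
      have covers: "valid_covers ps p ls us" and "p \<in> P"
        using row[of p ls us n] that by (auto simp: r P_def ps_def image_iff intro: bexI[rotated])
      have Tp: "Tplus P list_le p I = of_bool (p \<notin> I \<and> set ls \<subseteq> I)"
        using covers \<open>p \<in> P\<close> by (intro Tplus_eqI[OF I]) (auto simp: valid_covers_def P_def)
      have Tm: "Tminus P list_le p I = of_bool (p \<in> I \<and> set us \<inter> I = {})"
        using covers \<open>p \<in> P\<close> by (intro Tminus_eqI[OF I]) (auto simp: valid_covers_def P_def)
      have "N p = peval n"
        using N that by (simp add: r)
      then show ?thesis
        by (auto simp: r row_sum_def L(2) Tq_def Tp Tm)
    qed
    then have "peval C = (\<Sum>r\<leftarrow>T. peval D * Tminus P list_le (fst r) I - N (fst r) * Tq P list_le (fst r) I)"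
      unfolding total[OF L(1), symmetric] by (intro arg_cong[of _ _ sum_list] map_cong refl)
    also have "\<dots> = (\<Sum>p\<in>P. peval D * Tminus P list_le p I - N p * Tq P list_le p I)"
      by (simp add: sum_P ps_def comp_def)
    finally have "peval D * (\<Sum>p\<in>P. Tminus P list_le p I) - peval C = (\<Sum>p\<in>P. N p * Tq P list_le p I)"
      by (simp add: sum_subtractf sum_distrib_left)
    then have "(\<Sum>p\<in>P. Tminus P list_le p I) - peval C / peval D = (\<Sum>p\<in>P. N p * Tq P list_le p I) / peval D"
      using D0 by (simp add: field_simps)
    then show "(\<Sum>p\<in>P. Tminus P list_le p I) - peval C / peval D = (\<Sum>p\<in>P. N p / peval D * Tq P list_le p I)"
      by (simp add: sum_divide_distrib)
  qed
  then show ?thesis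
    by (simp add: P_def ps_def)
qed

section \<open>Coefficient tables for E6 and E7\<close>

text \<open>The numerators solve a linear system with one equation per ideal. The empty ideal puts
  -C in the last row, and the full ideal requires D + q N = C in the first.\<close>

definition E6_cert :: certificate where
  "E6_cert = [
    ([1,2,2,3,2,1], [[1,1,2,3,2,1]], [], [0,0,1,1,0,-1]),
    ([1,1,2,3,2,1], [[1,1,2,2,2,1]], [[1,2,2,3,2,1]], [0,1,2,1,-1,-1]),
    ([1,1,2,2,2,1], [[1,1,1,2,2,1], [1,1,2,2,1,1]], [[1,1,2,3,2,1]], [1,2,2,0,-1,-1]),
    ([1,1,1,2,2,1], [[1,1,1,2,1,1]], [[1,1,2,2,2,1]], [0,1,1,0,-1,-1]),
    ([1,1,2,2,1,1], [[1,1,1,2,1,1], [1,1,2,2,1,0]], [[1,1,2,2,2,1]], [1,1,1,0,-1,-1]),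
    ([1,1,1,2,1,1], [[1,1,1,1,1,1], [1,1,1,2,1,0]], [[1,1,1,2,2,1], [1,1,2,2,1,1]], [1,2,1,-1,-2,-1]),
    ([1,1,2,2,1,0], [[1,1,1,2,1,0]], [[1,1,2,2,1,1]], [0,0,1,0,-1,-1]),
    ([1,1,1,1,1,1], [[1,0,1,1,1,1], [1,1,1,1,1,0]], [[1,1,1,2,1,1]], [1,1,0,-1,-1,-1]),
    ([1,1,1,2,1,0], [[1,1,1,1,1,0]], [[1,1,1,2,1,1], [1,1,2,2,1,0]], [0,1,1,-1,-2,-1]),
    ([1,0,1,1,1,1], [[1,0,1,1,1,0]], [[1,1,1,1,1,1]], [0,0,0,0,-1,-1]),
    ([1,1,1,1,1,0], [[1,0,1,1,1,0], [1,1,1,1,0,0]], [[1,1,1,1,1,1], [1,1,1,2,1,0]], [1,1,0,-2,-2,-1]),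
    ([1,0,1,1,1,0], [[1,0,1,1,0,0]], [[1,0,1,1,1,1], [1,1,1,1,1,0]], [0,0,0,-1,-2,-1]),
    ([1,1,1,1,0,0], [[1,0,1,1,0,0]], [[1,1,1,1,1,0]], [0,0,0,-1,-1,-1]),
    ([1,0,1,1,0,0], [[1,0,1,0,0,0]], [[1,0,1,1,1,0], [1,1,1,1,0,0]], [0,0,-1,-2,-2,-1]),
    ([1,0,1,0,0,0], [[1,0,0,0,0,0]], [[1,0,1,1,0,0]], [0,-1,-1,-1,-1,-1]),
    ([1,0,0,0,0,0], [], [[1,0,1,0,0,0]], [-1,-1,0,0,-1,-1])]"

lemma antichain_const_E6: "antichain_const E6_set list_le"
proof -
  \<comment> \<open>In cyclotomic factors, [12] splits into D = Phi_3 Phi_12 and K = Phi_2 Phi_4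
    Phi_6. The rank sum is C K with C = (1 + q)(1 + q^4), so C/D is the constant in lowest
    terms.\<close>
  have "valid_certificate 10 [1,1,0,-1,0,1,1] [1,0,1,1,0,1] [1,1,0,0,1,1] E6_cert"
    by code_simp
  then have "antichain_const (set (map fst E6_cert)) list_le"
    by (rule antichain_const_certificate)
  moreover have "set (map fst E6_cert) = E6_set"
    by code_simp
  ultimately show ?thesis
    by simp
qed

definition E7_cert :: certificate where
  "E7_cert = [
    ([2,2,3,4,3,2,1], [[1,2,3,4,3,2,1]], [], [0,0,0,1,1,0,-1]),
    ([1,2,3,4,3,2,1], [[1,2,2,4,3,2,1]], [[2,2,3,4,3,2,1]], [0,0,1,2,1,-1,-1]),
    ([1,2,2,4,3,2,1], [[1,2,2,3,3,2,1]], [[1,2,3,4,3,2,1]], [0,1,2,2,0,-1,-1]),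
    ([1,2,2,3,3,2,1], [[1,1,2,3,3,2,1], [1,2,2,3,2,2,1]], [[1,2,2,4,3,2,1]], [1,2,2,1,0,-1,-1]),
    ([1,1,2,3,3,2,1], [[1,1,2,3,2,2,1]], [[1,2,2,3,3,2,1]], [0,1,1,1,0,-1,-1]),
    ([1,2,2,3,2,2,1], [[1,1,2,3,2,2,1], [1,2,2,3,2,1,1]], [[1,2,2,3,3,2,1]], [1,1,1,1,0,-1,-1]),
    ([1,1,2,3,2,2,1], [[1,1,2,2,2,2,1], [1,1,2,3,2,1,1]], [[1,1,2,3,3,2,1], [1,2,2,3,2,2,1]], [1,2,2,1,-1,-2,-1]),
    ([1,2,2,3,2,1,1], [[1,1,2,3,2,1,1]], [[1,2,2,3,2,2,1]], [0,0,1,1,0,-1,-1]),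
    ([1,1,2,2,2,2,1], [[1,1,1,2,2,2,1], [1,1,2,2,2,1,1]], [[1,1,2,3,2,2,1]], [1,2,1,0,-1,-1,-1]),
    ([1,1,2,3,2,1,1], [[1,1,2,2,2,1,1]], [[1,1,2,3,2,2,1], [1,2,2,3,2,1,1]], [0,1,2,1,-1,-2,-1]),
    ([1,1,1,2,2,2,1], [[0,1,1,2,2,2,1], [1,1,1,2,2,1,1]], [[1,1,2,2,2,2,1]], [1,1,0,0,0,-1,-1]),
    ([1,1,2,2,2,1,1], [[1,1,1,2,2,1,1], [1,1,2,2,1,1,1]], [[1,1,2,2,2,2,1], [1,1,2,3,2,1,1]], [1,2,2,0,-2,-2,-1]),
    ([0,1,1,2,2,2,1], [[0,1,1,2,2,1,1]], [[1,1,1,2,2,2,1]], [0,0,0,1,0,-1,-1]),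
    ([1,1,1,2,2,1,1], [[0,1,1,2,2,1,1], [1,1,1,2,1,1,1]], [[1,1,1,2,2,2,1], [1,1,2,2,2,1,1]], [1,1,1,0,-1,-2,-1]),
    ([1,1,2,2,1,1,1], [[1,1,1,2,1,1,1]], [[1,1,2,2,2,1,1]], [0,1,1,0,-1,-1,-1]),
    ([0,1,1,2,2,1,1], [[0,1,1,2,1,1,1]], [[0,1,1,2,2,2,1], [1,1,1,2,2,1,1]], [0,0,1,1,-1,-2,-1]),
    ([1,1,1,2,1,1,1], [[0,1,1,2,1,1,1], [1,1,1,1,1,1,1]], [[1,1,1,2,2,1,1], [1,1,2,2,1,1,1]], [1,2,1,-1,-2,-2,-1]),
    ([0,1,1,2,1,1,1], [[0,1,1,1,1,1,1]], [[0,1,1,2,2,1,1], [1,1,1,2,1,1,1]], [0,1,1,0,-2,-2,-1]),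
    ([1,1,1,1,1,1,1], [[0,1,1,1,1,1,1], [1,0,1,1,1,1,1]], [[1,1,1,2,1,1,1]], [1,1,0,-1,-1,-1,-1]),
    ([0,1,1,1,1,1,1], [[0,0,1,1,1,1,1], [0,1,0,1,1,1,1]], [[0,1,1,2,1,1,1], [1,1,1,1,1,1,1]], [1,1,0,-1,-2,-2,-1]),
    ([1,0,1,1,1,1,1], [[0,0,1,1,1,1,1]], [[1,1,1,1,1,1,1]], [0,0,0,0,0,-1,-1]),
    ([0,0,1,1,1,1,1], [[0,0,0,1,1,1,1]], [[0,1,1,1,1,1,1], [1,0,1,1,1,1,1]], [0,0,0,0,-1,-2,-1]),
    ([0,1,0,1,1,1,1], [[0,0,0,1,1,1,1]], [[0,1,1,1,1,1,1]], [0,0,0,0,-1,-1,-1]),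
    ([0,0,0,1,1,1,1], [[0,0,0,0,1,1,1]], [[0,0,1,1,1,1,1], [0,1,0,1,1,1,1]], [0,0,0,-1,-2,-2,-1]),
    ([0,0,0,0,1,1,1], [[0,0,0,0,0,1,1]], [[0,0,0,1,1,1,1]], [0,0,-1,-1,-1,-1,-1]),
    ([0,0,0,0,0,1,1], [[0,0,0,0,0,0,1]], [[0,0,0,0,1,1,1]], [0,-1,-1,0,0,-1,-1]),
    ([0,0,0,0,0,0,1], [], [[0,0,0,0,0,1,1]], [-1,-1,0,1,0,-1,-1])]"

lemma antichain_const_E7: "antichain_const E7_set list_le"
proof -
  \<comment> \<open>Here [18] splits into D = Phi_2 Phi_18 and K = Phi_3 Phi_6 Phi_9, and C = Phi_3
    Phi_12; again C/D is in lowest terms.\<close>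
  have "valid_certificate 16 [1,1,0,-1,-1,0,1,1] [1,0,1,1,1,1,1,1,1,0,1] [1,1,0,-1,0,1,1] E7_cert"
    by code_simp
  then have "antichain_const (set (map fst E7_cert)) list_le"
    by (rule antichain_const_certificate)
  moreover have "set (map fst E7_cert) = E7_set"
    by code_simp
  ultimately show ?thesis
    by simp
qed

theorem theorem5p16:
  fixes P :: "'a set" and le :: "'a \<Rightarrow> 'a \<Rightarrow> bool"
  assumes "minuscule P le"
  shows "q_equiv P le (\<lambda>I. \<Sum>p\<in>P. Tminus P le p I)
           (\<lambda>I. (\<Sum>p\<in>P. qvar ^ rk P le p) / qint (rkP P le + 2))"
proof -
  obtain Q leQ f where Q: "minuscule_model Q leQ" and f: "bij_betw f P Q"
    and iso: "\<And>x y. x \<in> P \<Longrightarrow> y \<in> P \<Longrightarrow> le x y \<longleftrightarrow> leQ (f x) (f y)"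
    using assms unfolding minuscule_def by blast
  have "antichain_const Q leQ"
    using Q antichain_const_rect antichain_const_stair antichain_const_diamond
      antichain_const_E6 antichain_const_E7
    unfolding minuscule_model_def by blast
  then have "antichain_const P le"
    using f iso by (rule antichain_const_iso)
  then show ?thesis
    by (simp only: antichain_const_def)
qed

end
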